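(* Suppose that $[X]=\varphi_{l,u}(X_{1:m})=[X_{(l)},X_{(u)}]$, where, conditionally on $(\mu,\tau)$, the variables $X_1,\ldots,X_m$ are i.i.d. with local density $f(x\mid\mu,\tau)$, which is interval-identifiable with location parameter $\mu$ and scale parameter $\tau>0$, and $(\mu,\tau)$ has global density $\pi(\mu,\tau)$. Further suppose that $l=l(m)$ and $u=u(m)$ satisfy $l/(m+1)\to\underline{p}>0$ and $u/(m+1)\to\overline{p}<1$ as $m\to\infty$ (with $\underline{p}<\overline{p}$), and that i) $\pi(\mu,\tau)$ is twice differentiable; ii) $f(x\mid\mu,\tau)$ is positive and continuous in neighbourhoods of $Q(\underline{p};\mu,\tau)$ and $Q(\overline{p};\mu,\tau)$; iii) $\iint |f^{\star}_{[X]}(\underline{x},\overline{x}\mid\mu,\tau,m,l,u)|\,\pi(\mu,\tau)\,\mathrm{d}\mu\,\mathrm{d}\tau<\infty$ for any $0<l<u<m$. Then, as $m\to\infty$, the density function of $[X]$, $$f_{[X]}(\underline{x},\overline{x}\mid m)=\iint f^{\star}_{[X]}(\underline{x},\overline{x}\mid\mu,\tau,m,l,u)\,\pi(\mu,\tau)\,\mathrm{d}\mu\,\mathrm{d}\tau,$$ converges pointwise (for $\underline{x}<\overline{x}$) to $$\pi_\star(\underline{x},\overline{x})=\pi\big(\mu(\underline{x},\overline{x};\underline{p},\overline{p}),\tau(\underline{x},\overline{x};\underline{p},\overline{p})\big)\times\big|J\big(\mu(\underline{x},\overline{x};\underline{p},\overline{p}),\tau(\underline{x},\overline{x};\underline{p},\overline{p});\underline{p},\overline{p}\big)\big|^{-1},$$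 where $(\mu(\underline{x},\overline{x};\underline{p},\overline{p}),\tau(\underline{x},\overline{x};\underline{p},\overline{p}))$ is the solution $(\mu,\tau)$ of $Q(\underline{p};\mu,\tau)=\underline{x}$, $Q(\overline{p};\mu,\tau)=\overline{x}$, and $|J|$ is the absolute value of the determinant of $$J(\mu,\tau;\underline{p},\overline{p})=\begin{pmatrix}\frac{\partial}{\partial\mu}Q(\underline{p};\mu,\tau)&\frac{\partial}{\partial\tau}Q(\underline{p};\mu,\tau)\\ \frac{\partial}{\partial\mu}Q(\overline{p};\mu,\tau)&\frac{\partial}{\partial\tau}Q(\overline{p};\mu,\tau)\end{pmatrix}.$$
   Context: $x_{(k)}$ denotes the $k$-th order statistic of $x_1,\ldots,x_m$, and $\varphi_{l,u}(x_{1:m})=[x_{(l)},x_{(u)}]$ with $l<u$. The density of a random interval $[X]=[\underline{X},\overline{X}]$ is the joint density of $(\underline{X},\overline{X})$. For each $(\mu,\tau)$, $F(\cdot\mid\mu,\tau)$ and $Q(\cdot;\mu,\tau)$ are the cumulative distribution function and quantile function of $f(\cdot\mid\mu,\tau)$. $\mu$ and $\tau$ are location and scale parameters in the usual sense: $f(x\mid\mu,\tau)=\tau^{-1}f_0((x-\mu)/\tau)$ for a fixed density $f_0$, $\mu\in\mathbb{R}$, $\tau>0$. The i.i.d. (conditional) density of $[X]$ given $(\mu,\tau)$ is the joint density of the $l$-th and $u$-th order statistics: for $\underline{x}\le\overline{x}$, $$f^{\star}_{[X]}(\underline{x},\overline{x}\mid\mu,\tau,m,l,u)=\frac{m!}{(l-1)!(u-l-1)!(m-u)!}F(\underline{x}\mid\mu,\tau)^{l-1}[F(\overline{x}\mid\mu,\tau)-F(\underline{x}\mid\mu,\tau)]^{u-l-1}[1-F(\overline{x}\mid\mu,\tau)]^{m-u}f(\underline{x}\mid\mu,\tau)f(\overline{x}\mid\mu,\tau).$$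 Interval-identifiable: the local density $f(x\mid\mu,\tau)$ is interval-identifiable if the system $Q(p;\mu,\tau)=\underline{x}$, $Q(p';\mu,\tau)=\overline{x}$, equating the quantiles at the lower and upper levels $p<p'$ ($p=l/(m+1)$, $p'=u/(m+1)$, and in the limit $p=\underline{p}$, $p'=\overline{p}$) to the interval endpoints $\underline{x}<\overline{x}$, has a unique solution $(\mu,\tau)$. Condition iii) is for all $\underline{x}<\overline{x}$ and all integers $l,u,m$ as indicated; condition ii) is for every $(\mu,\tau)$. *)

theory Defs
  imports "HOL-Probability.Probability"
begin

definition prob_density :: "(real \<Rightarrow> real) \<Rightarrow> bool" where
  "prob_density g \<longleftrightarrow>
     g \<in> borel_measurable borel \<and> (\<forall>x. 0 \<le> g x) \<and> (\<integral>\<^sup>+x. ennreal (g x) \<partial>lborel) = 1"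

definition density_cdf :: "(real \<Rightarrow> real) \<Rightarrow> real \<Rightarrow> real" where
  "density_cdf g = cdf (density lborel (\<lambda>x. ennreal (g x)))"

definition quantile :: "(real \<Rightarrow> real) \<Rightarrow> real \<Rightarrow> real" where
  "quantile g p = Inf {x. p \<le> density_cdf g x}"

text \<open>Parameters are pairs \<open>(\<mu>, \<tau>)\<close> with \<open>\<tau> > 0\<close>; the values of parametrised functions outside
  this set are irrelevant.\<close>

definition param_space :: "(real \<times> real) set" where
  "param_space = UNIV \<times> {0<..}"

definition location_scale_density :: "(real \<times> real \<Rightarrow> real \<Rightarrow> real) \<Rightarrow> bool" where
  "location_scale_density f \<longleftrightarrow>
     (\<exists>f0. prob_density f0 \<and>
        (\<forall>\<mu> \<tau> x. 0 < \<tau> \<longrightarrow> f (\<mu>, \<tau>) x = f0 ((x - \<mu>) / \<tau>) / \<tau>))"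

text \<open>The parameter \<open>\<theta>\<close> is such that the \<open>p\<close>- and \<open>p'\<close>-quantiles are the endpoints \<open>x\<close> and \<open>x'\<close>.\<close>

definition solves_quantiles ::
  "(real \<times> real \<Rightarrow> real \<Rightarrow> real) \<Rightarrow> real \<Rightarrow> real \<Rightarrow> real \<Rightarrow> real \<Rightarrow> real \<times> real \<Rightarrow> bool" where
  "solves_quantiles f p p' x x' \<theta> \<longleftrightarrow>
     \<theta> \<in> param_space \<and> quantile (f \<theta>) p = x \<and> quantile (f \<theta>) p' = x'"

definition identifiable_at :: "(real \<times> real \<Rightarrow> real \<Rightarrow> real) \<Rightarrow> real \<Rightarrow> real \<Rightarrow> bool" where
  "identifiable_at f p p' \<longleftrightarrow> (\<forall>x x'. x < x' \<longrightarrow> (\<exists>!\<theta>. solves_quantiles f p p' x x' \<theta>))"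

text \<open>\<open>p\<close> and \<open>p'\<close> are the limits of the levels \<open>l m / (m + 1)\<close> and \<open>u m / (m + 1)\<close>.\<close>

definition interval_identifiable ::
  "(real \<times> real \<Rightarrow> real \<Rightarrow> real) \<Rightarrow> (nat \<Rightarrow> nat) \<Rightarrow> (nat \<Rightarrow> nat) \<Rightarrow> real \<Rightarrow> real \<Rightarrow> bool" where
  "interval_identifiable f l u p p' \<longleftrightarrow>
     (\<forall>m. 0 < l m \<and> l m < u m \<and> u m \<le> m \<longrightarrow>
        identifiable_at f (real (l m) / (real m + 1)) (real (u m) / (real m + 1))) \<and>
     identifiable_at f p p'"

definition quantile_params ::
  "(real \<times> real \<Rightarrow> real \<Rightarrow> real) \<Rightarrow> real \<Rightarrow> real \<Rightarrow> real \<Rightarrow> real \<Rightarrow> real \<times> real" where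
  "quantile_params f p p' x x' = (THE \<theta>. solves_quantiles f p p' x x' \<theta>)"

definition quantile_jacobian ::
  "(real \<times> real \<Rightarrow> real \<Rightarrow> real) \<Rightarrow> real \<Rightarrow> real \<Rightarrow> real \<times> real \<Rightarrow> real^2^2" where
  "quantile_jacobian f p p' = (\<lambda>(\<mu>, \<tau>). vector
     [vector [deriv (\<lambda>a. quantile (f (a, \<tau>)) p) \<mu>, deriv (\<lambda>b. quantile (f (\<mu>, b)) p) \<tau>],
      vector [deriv (\<lambda>a. quantile (f (a, \<tau>)) p') \<mu>, deriv (\<lambda>b. quantile (f (\<mu>, b)) p') \<tau>]])"

definition limit_density ::
  "(real \<times> real \<Rightarrow> real \<Rightarrow> real) \<Rightarrow> (real \<times> real \<Rightarrow> real) \<Rightarrow> real \<Rightarrow> real \<Rightarrow> real \<Rightarrow> real \<Rightarrow> real" where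
  "limit_density f \<pi> p p' x x' =
     (let \<theta> = quantile_params f p p' x x'
      in \<pi> \<theta> * inverse \<bar>det (quantile_jacobian f p p' \<theta>)\<bar>)"

text \<open>The \<open>k\<close>-th smallest of \<open>x 1, \<dots>, x m\<close>, for \<open>1 \<le> k \<le> m\<close>.\<close>

definition order_stat :: "nat \<Rightarrow> nat \<Rightarrow> (nat \<Rightarrow> real) \<Rightarrow> real" where
  "order_stat m k x = sort (map x [1..<Suc m]) ! (k - 1)"

text \<open>An interval is represented by the pair of its endpoints.\<close>

definition order_interval :: "nat \<Rightarrow> nat \<Rightarrow> nat \<Rightarrow> (nat \<Rightarrow> real) \<Rightarrow> real \<times> real" where
  "order_interval m l u x = (order_stat m l x, order_stat m u x)"

text \<open>Joint density of the \<open>l\<close>-th and \<open>u\<close>-th order statistics of an i.i.d. sample of size \<open>m\<close>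
  from \<open>g\<close>, meaningful for \<open>0 < l < u \<le> m\<close>.\<close>

definition iid_interval_density ::
  "(real \<Rightarrow> real) \<Rightarrow> nat \<Rightarrow> nat \<Rightarrow> nat \<Rightarrow> real \<Rightarrow> real \<Rightarrow> real" where
  "iid_interval_density g m l u x x' =
     (if x \<le> x' then
        fact m / (fact (l - 1) * fact (u - l - 1) * fact (m - u)) *
        density_cdf g x ^ (l - 1) *
        (density_cdf g x' - density_cdf g x) ^ (u - l - 1) *
        (1 - density_cdf g x') ^ (m - u) * g x * g x'
      else 0)"

definition interval_density ::
  "(real \<times> real \<Rightarrow> real \<Rightarrow> real) \<Rightarrow> (real \<times> real \<Rightarrow> real) \<Rightarrow> nat \<Rightarrow> nat \<Rightarrow> nat \<Rightarrow> real \<Rightarrow> real \<Rightarrow> real"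
  where
  "interval_density f \<pi> m l u x x' =
     (LINT \<theta>:param_space|lborel. iid_interval_density (f \<theta>) m l u x x' * \<pi> \<theta>)"

text \<open>Conditionally on \<open>\<Theta>\<close>, the variables \<open>X 1, X 2, \<dots>\<close> are i.i.d. with density \<open>f \<Theta>\<close>: the joint
  law of \<open>\<Theta>\<close> and \<open>X 1, \<dots>, X m\<close> disintegrates over the law of \<open>\<Theta>\<close> into products.\<close>

definition cond_iid ::
  "'a measure \<Rightarrow> ('a \<Rightarrow> real \<times> real) \<Rightarrow> (real \<times> real \<Rightarrow> real \<Rightarrow> real) \<Rightarrow> (nat \<Rightarrow> 'a \<Rightarrow> real) \<Rightarrow> bool"
  where
  "cond_iid M \<Theta> f X \<longleftrightarrow>
     (\<forall>i\<ge>1. X i \<in> borel_measurable M) \<and>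
     (\<forall>m A B. A \<in> sets borel \<longrightarrow> (\<forall>i\<in>{1..m}. B i \<in> sets borel) \<longrightarrow>
        emeasure M {\<omega> \<in> space M. \<Theta> \<omega> \<in> A \<and> (\<forall>i\<in>{1..m}. X i \<omega> \<in> B i)} =
        (\<integral>\<^sup>+\<theta>\<in>A. (\<Prod>i\<in>{1..m}. \<integral>\<^sup>+x\<in>B i. ennreal (f \<theta> x) \<partial>lborel) \<partial>distr M borel \<Theta>))"

definition twice_differentiable_on ::
  "('a::real_normed_vector \<Rightarrow> 'b::real_normed_vector) \<Rightarrow> 'a set \<Rightarrow> bool" where
  "twice_differentiable_on h S \<longleftrightarrow>
     (\<exists>h' :: 'a \<Rightarrow> 'a \<Rightarrow>\<^sub>L 'b. \<forall>x\<in>S.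
        (h has_derivative blinfun_apply (h' x)) (at x) \<and> h' differentiable (at x))"

definition positive_continuous_near :: "(real \<Rightarrow> real) \<Rightarrow> real \<Rightarrow> bool" where
  "positive_continuous_near g q \<longleftrightarrow>
     (\<exists>U. open U \<and> q \<in> U \<and> (\<forall>x\<in>U. 0 < g x) \<and> continuous_on U g)"

end

(* A location-scale family turns the parameter (mu, tau) into the pair of standardised endpoints
   a = (x - mu) / tau and b = (x' - mu) / tau, with dmu dtau = tau^3 / (x' - x) da db. The density
   of [X] at (x, x') thereby becomes the expectation, under the law of the l-th and u-th order
   statistics (a, b) of f0, of pi(mu, tau) tau / (x' - x) = pi(mu, tau) / (b - a).
   As m grows this law concentrates at the quantiles (q, q') of f0, giving the limit
   pi(mu, tau) / (q' - q), and q' - q is the determinant of J.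

   Tails are controlled by relating the order statistic density of sample size m to the one with
   (m, l, u) = (3, 1, 2): the quotient is a polynomial factor times a multinomial probability, which
   is exponentially small away from (F a, F b) = (p, p'), whereas the integral of pi against the
   fixed density is finite by hypothesis iii. *)

theory Submission
  imports Defs
begin

section \<open>Distribution functions and ranks\<close>

text \<open>Concentration of the order statistics alone does not give the limit:
  \<open>\<pi>\<close> may be unbounded, and condition iii yields finiteness for each sample size
  separately, without uniformity in m. Hence all integrals are taken against one fixed probability
  measure on the parameters, the one belonging to sample size 3, and m enters through a weight only.
  The triple (3, 1, 2) is the smallest with 0 < l < u < m; its density 6 f(a) f(b) (1 - F(b))
  divides every other one up to nonnegative powers of F(a), F(b) - F(a) and 1 - F(b). The weighted
  measure has mass 1 for every m, because an order statistic density has; so a crude polynomial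
  factor times an exponential suffices, and neither Stirling asymptotics nor a central limit theorem
  is used. The weight sees (a, b) only through F(a) and F(b); condition ii turns closeness of these
  to p and p' into closeness of (a, b) to (q, q'). That the integral is a density of [X] at all is a
  matter of combinatorics (which observations take which ranks) and of extending the conditional law
  from rectangles to all events.\<close>

lemma prob_densityD:
  assumes "prob_density g"
  shows "g \<in> borel_measurable borel" "\<And>x. 0 \<le> g x" "(\<integral>\<^sup>+x. ennreal (g x) \<partial>lborel) = 1"
  using assms by (auto simp: prob_density_def)

lemma real_distribution_density:
  assumes "prob_density g"
  shows "real_distribution (density lborel (\<lambda>x. ennreal (g x)))"
proof -
  have [measurable]: "g \<in> borel_measurable borel" using assms by (rule prob_densityD)
  have "prob_space (density lborel (\<lambda>x. ennreal (g x)))"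
    by (rule prob_spaceI) (simp add: emeasure_density prob_densityD(3)[OF assms])
  then show ?thesis
    by (simp add: real_distribution_def real_distribution_axioms_def)
qed

lemma emeasure_density_singleton:
  assumes "prob_density g"
  shows "emeasure (density lborel (\<lambda>x. ennreal (g x))) {a} = 0"
proof -
  have [measurable]: "g \<in> borel_measurable borel" using assms by (rule prob_densityD)
  have "AE x in lborel. ennreal (g x) * indicator {a} x = 0"
    using AE_lborel_singleton[of a] by eventually_elim auto
  then show ?thesis
    by (simp add: emeasure_density nn_integral_0_iff_AE)
qed

text \<open>Points are null sets, so the open half-lines of \<open>rank_region\<close> can replace
  the closed ones in the definition of \<open>cdf\<close>.\<close>

lemma nn_integral_density_less:
  assumes "prob_density g"
  shows "(\<integral>\<^sup>+x. ennreal (g x) * indicator {..<a} x \<partial>lborel) = ennreal (density_cdf g a)"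
proof -
  interpret real_distribution "density lborel (\<lambda>x. ennreal (g x))"
    by (rule real_distribution_density) fact
  have [measurable]: "g \<in> borel_measurable borel" using assms by (rule prob_densityD)
  have "ennreal (density_cdf g a) = emeasure (density lborel (\<lambda>x. ennreal (g x))) {..a}"
    by (simp add: density_cdf_def cdf_def emeasure_eq_measure)
  also have "{..a} = {..<a} \<union> {a}" by auto
  also have "emeasure (density lborel (\<lambda>x. ennreal (g x))) ({..<a} \<union> {a}) =
     emeasure (density lborel (\<lambda>x. ennreal (g x))) {..<a}"
    using emeasure_density_singleton[OF assms, of a] by (subst plus_emeasure[symmetric]) auto
  also have "\<dots> = (\<integral>\<^sup>+x. ennreal (g x) * indicator {..<a} x \<partial>lborel)"
    by (simp add: emeasure_density)
  finally show ?thesis by simp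
qed

lemma nn_integral_density_greater:
  assumes "prob_density g"
  shows "(\<integral>\<^sup>+x. ennreal (g x) * indicator {b<..} x \<partial>lborel) = ennreal (1 - density_cdf g b)"
proof -
  interpret real_distribution "density lborel (\<lambda>x. ennreal (g x))"
    by (rule real_distribution_density) fact
  have [measurable]: "g \<in> borel_measurable borel" using assms by (rule prob_densityD)
  have "{b<..} = UNIV - {..b}" by auto
  then have "measure (density lborel (\<lambda>x. ennreal (g x))) {b<..} = 1 - density_cdf g b"
    using prob_compl[of "{..b}"] by (simp add: density_cdf_def cdf_def)
  then show ?thesis
    by (simp add: emeasure_density[symmetric] emeasure_eq_measure)
qed

lemma density_cdf_mono: "prob_density g \<Longrightarrow> a \<le> b \<Longrightarrow> density_cdf g a \<le> density_cdf g b"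
  unfolding density_cdf_def
  by (intro finite_borel_measure.cdf_nondecreasing real_distribution.finite_borel_measure_M
      real_distribution_density)

lemma density_cdf_nonneg: "0 \<le> density_cdf g a"
  by (simp add: density_cdf_def cdf_def)

lemma density_cdf_le_1: "prob_density g \<Longrightarrow> density_cdf g a \<le> 1"
  unfolding density_cdf_def
  by (intro real_distribution.cdf_bounded_prob real_distribution_density)

lemma isCont_density_cdf:
  assumes "prob_density g"
  shows "isCont (density_cdf g) a"
proof -
  interpret real_distribution "density lborel (\<lambda>x. ennreal (g x))"
    by (rule real_distribution_density) fact
  show ?thesis
    using emeasure_density_singleton[OF assms, of a]
    by (simp add: density_cdf_def isCont_cdf measure_def)
qed

lemma borel_measurable_density_cdf:
  assumes "prob_density g"
  shows "density_cdf g \<in> borel_measurable borel"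
  using assms
  by (intro borel_measurable_continuous_onI continuous_at_imp_continuous_on ballI isCont_density_cdf)

lemma nn_integral_density_between:
  assumes "prob_density g" "a < b"
  shows "(\<integral>\<^sup>+x. ennreal (g x) * indicator {a<..<b} x \<partial>lborel) = 
    ennreal (density_cdf g b - density_cdf g a)"
proof -
  interpret real_distribution "density lborel (\<lambda>x. ennreal (g x))"
    by (rule real_distribution_density) fact
  have [measurable]: "g \<in> borel_measurable borel" using assms(1) by (rule prob_densityD)
  let ?D = "density lborel (\<lambda>x. ennreal (g x))"
  have "ennreal (density_cdf g b - density_cdf g a) = emeasure ?D {a<..b}"
    using assms(2) cdf_diff_eq[of a b] by (simp add: density_cdf_def emeasure_eq_measure)
  also have "{a<..b} = {a<..<b} \<union> {b}" using assms(2) by auto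
  also have "emeasure ?D ({a<..<b} \<union> {b}) = emeasure ?D {a<..<b}"
    using emeasure_density_singleton[OF assms(1), of b] by (subst plus_emeasure[symmetric]) auto
  also have "\<dots> = (\<integral>\<^sup>+x. ennreal (g x) * indicator {a<..<b} x \<partial>lborel)"
    by (simp add: emeasure_density)
  finally show ?thesis by simp
qed

section \<open>Ranks in samples without ties\<close>

lemma sorted_distinct_card_less:
  fixes ys :: "'a::linorder list"
  assumes "sorted ys" "distinct ys" "r < length ys"
  shows "card {y \<in> set ys. y < ys ! r} = r"
proof -
  have "{y \<in> set ys. y < ys ! r} = (!) ys ` {..<r}"
  proof (intro set_eqI iffI)
    fix y assume y: "y \<in> {y \<in> set ys. y < ys ! r}"
    then obtain k where k: "k < length ys" "y = ys ! k" by (auto simp: in_set_conv_nth)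
    have "k < r"
      using y k assms sorted_nth_mono[of ys r k] by force
    then show "y \<in> (!) ys ` {..<r}" using k by auto
  next
    fix y assume "y \<in> (!) ys ` {..<r}"
    then obtain k where k: "k < r" "y = ys ! k" by auto
    have "ys ! k \<le> ys ! r" using assms k sorted_nth_mono[of ys k r] by auto
    moreover have "ys ! k \<noteq> ys ! r" using assms k nth_eq_iff_index_eq[of ys k r] by auto
    ultimately show "y \<in> {y \<in> set ys. y < ys ! r}" using k assms by auto
  qed
  moreover have "inj_on ((!) ys) {..<r}"
    using assms by (auto intro!: inj_onI simp: nth_eq_iff_index_eq)
  ultimately show ?thesis by (simp add: card_image)
qed

text \<open>Sorting is traded for counting: the k-th smallest of distinct values is the one with k -
  1 values below it, a description by indices instead of list positions.\<close>

lemma order_stat_eqD: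
  assumes inj: "inj_on x {1..m}" and k: "1 \<le> k" "k \<le> m" 
  shows "\<exists>i\<in>{1..m}. order_stat m k x = x i \<and> card {j\<in>{1..m}. x j < x i} = k - 1"
proof -
  define ys where "ys = sort (map x [1..<Suc m])"
  have set: "set ys = x ` {1..m}" 
    by (auto simp: ys_def)
  have ys: "sorted ys" "distinct ys" "length ys = m"
    using inj by (auto simp: ys_def distinct_map atLeastLessThanSuc_atLeastAtMost simp del: upt_Suc)
  have "ys ! (k - 1) \<in> set ys" using ys k by auto
  then obtain i where i: "i \<in> {1..m}" "ys ! (k - 1) = x i" unfolding set by auto
  have "k - 1 = card {y \<in> set ys. y < ys ! (k - 1)}"
    using ys k by (subst sorted_distinct_card_less) auto
  also have "{y \<in> set ys. y < ys ! (k - 1)} = x ` {j\<in>{1..m}. x j < x i}"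
    unfolding set i by auto
  also have "card \<dots> = card {j\<in>{1..m}. x j < x i}"
    by (rule card_image, rule inj_on_subset[OF inj]) auto
  finally show ?thesis using i by (auto simp: order_stat_def ys_def)
qed

text \<open>Different values have different ranks; this makes the value with a prescribed rank
  unique.\<close>

lemma card_less_strict_mono:
  fixes x :: "'a \<Rightarrow> 'b::linorder"
  assumes "finite I" "i \<in> I" "x i < x j"
  shows "card {k\<in>I. x k < x i} < card {k\<in>I. x k < x j}"
  using assms by (intro psubset_card_mono) auto

lemma order_stat_eq_iff:
  assumes inj: "inj_on x {1..m}" and k: "1 \<le> k" "k \<le> m" and i: "i \<in> {1..m}"
  shows "order_stat m k x = x i \<longleftrightarrow> card {j\<in>{1..m}. x j < x i} = k - 1"
proof -
  obtain i' where i': "i' \<in> {1..m}" "order_stat m k x = x i'" "card {j\<in>{1..m}. x j < x i'} = k - 1"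
    using order_stat_eqD[OF inj k] by auto
  show ?thesis
    using i' i card_less_strict_mono[of "{1..m}" i x i'] card_less_strict_mono[of "{1..m}" i' x i]
    by (cases "x i" "x i'" rule: linorder_cases) auto
qed

text \<open>A pattern \<open>(i, j, S, T)\<close> records that \<open>x i\<close> is the \<open>l\<close>-th and \<open>x j\<close> the \<open>u\<close>-th order statistic, that \<open>S\<close> indexes
  the values below \<open>x i\<close>, and \<open>T\<close> those strictly between. Without ties exactly one pattern occurs,
  and conditionally on \<open>(x i, x j)\<close> its probability is a product.\<close>

definition rank_region :: "'i set \<Rightarrow> 'i set \<Rightarrow> real \<Rightarrow> real \<Rightarrow> 'i \<Rightarrow> real set" where
  "rank_region S T a b k = (if k \<in> S then {..<a} else if k \<in> T then {a<..<b} else {b<..})"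

definition rank_patterns :: "'i set \<Rightarrow> nat \<Rightarrow> nat \<Rightarrow> ('i \<times> 'i \<times> 'i set \<times> 'i set) set" where
  "rank_patterns I l u = (SIGMA i:I. SIGMA j:I - {i}.
     SIGMA S:{S. S \<subseteq> I - {i, j} \<and> card S = l - 1}. {T. T \<subseteq> I - {i, j} - S \<and> card T = u - l - 1})"

definition has_rank_pattern :: "'i set \<Rightarrow> ('i \<Rightarrow> real) \<Rightarrow> 'i \<times> 'i \<times> 'i set \<times> 'i set \<Rightarrow> bool" where
  "has_rank_pattern I x = (\<lambda>(i, j, S, T). x i < x j \<and>
     (\<forall>k\<in>I - {i, j}. x k \<in> rank_region S T (x i) (x j) k))"

lemma finite_rank_patterns: "finite I \<Longrightarrow> finite (rank_patterns I l u)"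
  unfolding rank_patterns_def by (intro finite_SigmaI) auto

text \<open>There are m (m - 1) ordered pairs (i, j); then l - 1 of the other m - 2 indices go to S,
  and u - l - 1 of the remaining m - l - 1 go to T. The factorials (m - 2)! and (m - l - 1)! cancel,
  which leaves the constant of \<open>iid_interval_density\<close>.\<close>

lemma card_rank_patterns:
  assumes I: "finite I" "card I = m" and l: "0 < l" "l < u" "u \<le> m"
  shows "real (card (rank_patterns I l u)) =
    fact m / (fact (l - 1) * fact (u - l - 1) * fact (m - u))"
proof -
  have "card (SIGMA S:{S. S \<subseteq> R \<and> card S = l - 1}. {T. T \<subseteq> R - S \<and> card T = u - l - 1}) = 
    ((m - 2) choose (l - 1)) * ((m - l - 1) choose (u - l - 1))" if R: "finite R" "card R = m - 2" for R :: "'a set"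
  proof -
    have "card {T. T \<subseteq> R - S \<and> card T = u - l - 1} = ((m - l - 1) choose (u - l - 1))"
      if "S \<in> {S. S \<subseteq> R \<and> card S = l - 1}" for S
    proof -
      have "card (R - S) = m - l - 1" using that R l by (auto simp: card_Diff_subset finite_subset)
      then show ?thesis using R by (simp add: n_subsets)
    qed
    moreover have "finite {S. S \<subseteq> R \<and> card S = l - 1}" using R by auto
    moreover have "finite {T. T \<subseteq> R - S \<and> card T = u - l - 1}" for S using R by auto
    ultimately show ?thesis 
      using R by (subst card_SigmaI) (auto simp: n_subsets)
  qed note 1 = this
  have fin: "finite (SIGMA S:{S. S \<subseteq> R \<and> card S = l - 1}. {T. T \<subseteq> R - S \<and> card T = u - l - 1})"
    if "finite R" for R :: "'a set"
    using that by (intro finite_SigmaI) auto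
  have "card (rank_patterns I l u) = (\<Sum>i\<in>I. \<Sum>j\<in>I - {i}. 
     ((m - 2) choose (l - 1)) * ((m - l - 1) choose (u - l - 1)))"
    unfolding rank_patterns_def
  proof (subst card_SigmaI, goal_cases)
    case 2 show ?case using I fin by (auto intro!: finite_SigmaI)
  next
    case 3 show ?case
    proof (rule sum.cong[OF refl], subst card_SigmaI, goal_cases)
      case (3 i) show ?case
      proof (rule sum.cong[OF refl], rule 1, goal_cases)
        case (2 j) then show ?case using 3 I
          by (auto simp: card_Diff_subset card_insert_if numeral_2_eq_2)
      qed (use I in auto)
    qed (use I fin in auto)
  qed (use I in auto)
  also have "\<dots> = m * (m - 1) * (((m - 2) choose (l - 1)) * ((m - l - 1) choose (u - l - 1)))"
    using I by simp
  finally have c: "real (card (rank_patterns I l u)) = real m * real (m - 1) * 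
     (real ((m - 2) choose (l - 1)) * real ((m - l - 1) choose (u - l - 1)))"
    by (simp only: of_nat_mult)
  have f: "(fact m :: real) = real m * real (m - 1) * fact (m - 2)"
    using l fact_reduce[of m, where 'a=real] fact_reduce[of "m - 1", where 'a=real] by (simp add: numeral_2_eq_2)
  have "real ((m - 2) choose (l - 1)) = fact (m - 2) / (fact (l - 1) * fact (m - l - 1))"
    using l by (subst binomial_fact) auto
  moreover have "real ((m - l - 1) choose (u - l - 1)) = fact (m - l - 1) / (fact (u - l - 1) * fact (m - u))"
    using l by (subst binomial_fact) auto
  ultimately show ?thesis unfolding c f by simp
qed

lemma less_split_at:
  fixes x :: "'a \<Rightarrow> 'b::linorder"
  assumes "inj_on x I" "i \<in> I" "x i < x j"
  shows "{k\<in>I. x k < x j} = insert i ({k\<in>I. x k < x i} \<union> {k\<in>I. x i < x k \<and> x k < x j})"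
proof (intro set_eqI iffI)
  fix k assume k: "k \<in> {k\<in>I. x k < x j}"
  then show "k \<in> insert i ({k\<in>I. x k < x i} \<union> {k\<in>I. x i < x k \<and> x k < x j})"
    using inj_on_eq_iff[OF assms(1) _ assms(2), of k]
    by (cases "x k" "x i" rule: linorder_cases) auto
qed (use assms in auto)

text \<open>The three regions are disjoint, so a pattern that occurs has its S and T determined by
  the values at \<open>i\<close> and \<open>j\<close>. Uniqueness of the pattern thus reduces to
  uniqueness of \<open>i\<close> and \<open>j\<close>.\<close>

lemma rank_patternD:
  assumes "(i, j, S, T) \<in> rank_patterns I l u" "has_rank_pattern I x (i, j, S, T)"
  shows "i \<in> I" "j \<in> I" "j \<noteq> i" "S \<subseteq> I - {i, j}" "card S = l - 1"
    "T \<subseteq> I - {i, j} - S" "card T = u - l - 1" "x i < x j"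
    "S = {k\<in>I. x k < x i}" "T = {k\<in>I. x i < x k \<and> x k < x j}"
proof -
  show a: "i \<in> I" "j \<in> I" "j \<noteq> i" "S \<subseteq> I - {i, j}" "card S = l - 1" 
    "T \<subseteq> I - {i, j} - S" "card T = u - l - 1"
    using assms(1) by (auto simp: rank_patterns_def)
  show ij: "x i < x j"
    using assms(2) by (auto simp: has_rank_pattern_def)
  have k: "k \<in> S \<and> x k < x i \<or> k \<in> T \<and> k \<notin> S \<and> x i < x k \<and> x k < x j \<or>
      k \<notin> S \<and> k \<notin> T \<and> x j < x k" if "k \<in> I - {i, j}" for k
    using assms(2) that by (auto simp: has_rank_pattern_def rank_region_def split: if_splits)
  show "S = {k\<in>I. x k < x i}"
  proof (intro set_eqI)
    fix k show "k \<in> S \<longleftrightarrow> k \<in> {k\<in>I. x k < x i}"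
      using k[of k] ij a(4) by (cases "k \<in> I - {i, j}") (fastforce+)
  qed
  show "T = {k\<in>I. x i < x k \<and> x k < x j}"
  proof (intro set_eqI)
    fix k show "k \<in> T \<longleftrightarrow> k \<in> {k\<in>I. x i < x k \<and> x k < x j}"
      using k[of k] ij a(6) by (cases "k \<in> I - {i, j}") (fastforce+)
  qed
qed

lemma ex1_rank_pattern:
  assumes inj: "inj_on x {1..m}" and l: "0 < l" "l < u" "u \<le> m"
  shows "\<exists>i j S T. order_interval m l u x = (x i, x j) \<and>
    {t \<in> rank_patterns {1..m} l u. has_rank_pattern {1..m} x t} = {(i, j, S, T)}"
proof -
  let ?I = "{1..m}"
  obtain i where i: "i \<in> ?I" "order_stat m l x = x i" "card {k\<in>?I. x k < x i} = l - 1"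
    using order_stat_eqD[OF inj, of l] l by auto
  obtain j where j: "j \<in> ?I" "order_stat m u x = x j" "card {k\<in>?I. x k < x j} = u - 1"
    using order_stat_eqD[OF inj, of u] l by auto
  have ij: "x i < x j"
    using i j l card_less_strict_mono[of ?I j x i] inj
    by (cases "x i" "x j" rule: linorder_cases) auto
  define S where "S = {k\<in>?I. x k < x i}"
  define T where "T = {k\<in>?I. x i < x k \<and> x k < x j}"
  \<comment> \<open>The u - 1 values below \<open>x j\<close> are \<open>x i\<close>, the l - 1
    values below it and the values in between; this gives \<open>card T\<close>.\<close>
  have "{k\<in>?I. x k < x j} = insert i (S \<union> T)"
    using less_split_at[OF inj i(1) ij] by (simp add: S_def T_def)
  moreover have "card (insert i (S \<union> T)) = 1 + (card S + card T)"
    by (subst card_insert_disjoint) (auto simp: S_def T_def intro!: card_Un_disjoint)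
  ultimately have cT: "card T = u - l - 1" using j i l by (simp add: S_def)
  have 1: "(i, j, S, T) \<in> rank_patterns ?I l u"
    using i j ij cT by (auto simp: rank_patterns_def S_def T_def)
  have 2: "has_rank_pattern ?I x (i, j, S, T)"
  proof -
    have "x k > x j" if "k \<in> ?I - {i, j}" "k \<notin> S" "k \<notin> T" for k
      using that inj_on_eq_iff[OF inj, of k i] inj_on_eq_iff[OF inj, of k j] i j
      by (auto simp: S_def T_def not_less)
    then show ?thesis using ij
      by (auto simp: has_rank_pattern_def rank_region_def) (auto simp: S_def T_def)
  qed
  \<comment> \<open>The number of values below \<open>x i'\<close> is
    \<open>card S' = l - 1\<close>, so \<open>i'\<close> is \<open>i\<close>; counting then leaves u
    - 1 values below \<open>x j'\<close>, so \<open>j'\<close> is \<open>j\<close>, and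
    \<open>S'\<close> and \<open>T'\<close> follow.\<close>
  have 3: "(i', j', S', T') = (i, j, S, T)"
    if "(i', j', S', T') \<in> rank_patterns ?I l u" "has_rank_pattern ?I x (i', j', S', T')"
    for i' j' S' T'
  proof -
    note pat = rank_patternD[OF that]
    note a = pat(1-7) and b = pat(8) and S' = pat(9) and T' = pat(10)
    have "x i' = x i" 
      using order_stat_eq_iff[OF inj _ _ a(1), of l] a(5)[unfolded S'] i(2) l by simp
    then have i': "i' = i" using inj_on_eq_iff[OF inj a(1) i(1)] by simp
    have "{k\<in>?I. x k < x j'} = insert i' (S' \<union> T')"
      using less_split_at[OF inj a(1) b(1)] by (simp add: S' T')
    moreover have "card (insert i' (S' \<union> T')) = 1 + (card S' + card T')"
    proof (subst card_insert_disjoint)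
      show "finite (S' \<union> T')" unfolding S' T' by auto
      show "i' \<notin> S' \<union> T'" unfolding S' T' by auto
      have "S' \<inter> T' = {}" using a(6) by auto
      moreover have "finite S'" "finite T'" unfolding S' T' by auto
      ultimately show "Suc (card (S' \<union> T')) = 1 + (card S' + card T')"
        by (simp add: card_Un_disjoint)
    qed
    ultimately have "card {k\<in>?I. x k < x j'} = 1 + ((l - 1) + (u - l - 1))" 
      unfolding a(5,7) by (rule trans[OF arg_cong[where f=card]])
    then have "card {k\<in>?I. x k < x j'} = u - 1" using l by simp
    then have "x j' = x j" 
      using order_stat_eq_iff[OF inj _ l(3) a(2)] j(2) l by auto
    then have j': "j' = j" using inj_on_eq_iff[OF inj a(2) j(1)] by simp
    show ?thesis unfolding S' T' i' j' S_def T_def by (rule refl)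
  qed
  have "{t \<in> rank_patterns ?I l u. has_rank_pattern ?I x t} = {(i, j, S, T)}"
  proof (intro equalityI subsetI)
    fix t assume t: "t \<in> {t \<in> rank_patterns ?I l u. has_rank_pattern ?I x t}"
    obtain i' j' S' T' where "t = (i', j', S', T')" by (cases t)
    with t 3 show "t \<in> {(i, j, S, T)}" by blast
  qed (use 1 2 in simp)
  then show ?thesis
    using i(2) j(2) unfolding order_interval_def by blast
qed

section \<open>Joint density of two order statistics\<close>

interpretation lborel_family: product_sigma_finite "\<lambda>_::nat. lborel :: real measure"
  by standard

text \<open>With all coordinates but \<open>i\<close> fixed, a tie means that \<open>x i\<close>
  hits the single point \<open>x j\<close>, a null set; Fubini over coordinate \<open>i\<close> does
  the rest.\<close>

lemma AE_PiM_lborel_neq: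
  assumes "finite I" "i \<in> I" "j \<in> I" "i \<noteq> j"
  shows "AE x in PiM I (\<lambda>_::nat. lborel :: real measure). x i \<noteq> x j"
proof -
  let ?P = "\<lambda>J. PiM J (\<lambda>_::nat. lborel :: real measure)"
  let ?f = "\<lambda>x :: nat \<Rightarrow> real. if x i = x j then 1 else 0 :: ennreal"
  define R where "R = I - {i}"
  have I: "I = insert i R" "finite R" "i \<notin> R" "j \<in> R" using assms by (auto simp: R_def)
  have meas: "?f \<in> borel_measurable (?P (insert i R))"
  proof -
    have [measurable]: "(\<lambda>x. x k) \<in> borel_measurable (?P (insert i R))" if "k \<in> insert i R" for k
      using that by measurable
    show ?thesis
      using I(4) by (intro measurable_If measurable_const borel_measurable_eq) auto
  qed
  have "(\<integral>\<^sup>+x. ?f x \<partial>?P (insert i R)) = (\<integral>\<^sup>+x. (\<integral>\<^sup>+y. ?f (x(i := y)) \<partial>lborel) \<partial>?P R)"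
    by (rule lborel_family.product_nn_integral_insert[OF I(2,3) meas])
  also have "(\<integral>\<^sup>+y. ?f (x(i := y)) \<partial>lborel) = 0" for x
  proof -
    have "AE y in lborel. ?f (x(i := y)) = 0"
      using AE_lborel_singleton[of "x j"] by eventually_elim (use assms in auto)
    then show ?thesis by (simp add: nn_integral_cong_AE)
  qed
  then have "(\<integral>\<^sup>+x. (\<integral>\<^sup>+y. ?f (x(i := y)) \<partial>lborel) \<partial>?P R) = 0" by simp
  finally have "(\<integral>\<^sup>+x. ?f x \<partial>?P I) = 0" unfolding I(1) .
  then have "AE x in ?P I. ?f x = 0" using meas unfolding I(1) by (simp only: nn_integral_0_iff_AE)
  then show ?thesis by eventually_elim (auto split: if_splits)
qed

lemma AE_PiM_lborel_inj_on:
  assumes "finite I"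
  shows "AE x in PiM I (\<lambda>_::nat. lborel :: real measure). inj_on x I"
proof -
  have "AE x in PiM I (\<lambda>_::nat. lborel :: real measure). \<forall>i\<in>I. \<forall>j\<in>I - {i}. x i \<noteq> x j"
    using assms by (intro AE_finite_allI AE_PiM_lborel_neq) auto
  then show ?thesis by eventually_elim (auto simp: inj_on_def)
qed

lemma borel_measurable_rank_pattern:
  fixes C :: "(real \<times> real) set"
  assumes I: "finite I" "i \<in> I" "j \<in> I" and C: "C \<in> sets borel"
  shows "(\<lambda>x. if has_rank_pattern I x (i, j, S, T) then indicator C (x i, x j) else 0 :: ennreal)
    \<in> borel_measurable (PiM I (\<lambda>_. borel :: real measure))"
proof -
  note [measurable] = C
  have [measurable]: "(\<lambda>x. x k) \<in> borel_measurable (PiM I (\<lambda>_. borel :: real measure))" if "k \<in> I" for k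
    using that by measurable
  have 1: "Measurable.pred (PiM I (\<lambda>_. borel :: real measure)) (\<lambda>x. x k \<in> rank_region S T (x i) (x j) k)"
    if "k \<in> I" for k
    unfolding rank_region_def using that I
    by (cases "k \<in> S"; cases "k \<in> T") auto
  have [measurable]: "Measurable.pred (PiM I (\<lambda>_. borel :: real measure)) (\<lambda>x. has_rank_pattern I x (i, j, S, T))"
    unfolding has_rank_pattern_def prod.case
    using I 1 by (intro pred_intros_logic pred_intros_finite) auto
  have [measurable]: "(\<lambda>x. (x i, x j)) \<in> measurable (PiM I (\<lambda>_. borel :: real measure)) borel"
    using I by (intro borel_measurable_Pair) auto
  show ?thesis by measurable
qed

lemma prod_rank_region:
  assumes g: "prob_density g" and ab: "a < b" and R: "finite R" "S \<subseteq> R" "T \<subseteq> R - S"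
  shows "(\<Prod>k\<in>R. \<integral>\<^sup>+x. ennreal (g x) * indicator (rank_region S T a b k) x \<partial>lborel) =
    ennreal (density_cdf g a ^ card S * (density_cdf g b - density_cdf g a) ^ card T *
      (1 - density_cdf g b) ^ (card R - card S - card T))"
proof -
  define h where "h k = (\<integral>\<^sup>+x. ennreal (g x) * indicator (rank_region S T a b k) x \<partial>lborel)" for k
  have F: "0 \<le> density_cdf g a" "0 \<le> density_cdf g b - density_cdf g a" "0 \<le> 1 - density_cdf g b"
    using density_cdf_nonneg density_cdf_mono[OF g, of a b] density_cdf_le_1[OF g] ab by auto
  have h: "h k = (if k \<in> S then ennreal (density_cdf g a) else if k \<in> T
      then ennreal (density_cdf g b - density_cdf g a) else ennreal (1 - density_cdf g b))" for k
    by (simp add: h_def rank_region_def nn_integral_density_less[OF g] nn_integral_density_greater[OF g]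
        nn_integral_density_between[OF g ab])
  have fin: "finite S" "finite T" using R by (auto intro: finite_subset)
  have "prod h R = prod h (R - S - T) * prod h T * prod h S"
    using R by (simp add: prod.subset_diff[of S R] prod.subset_diff[of T "R - S"])
  also have "prod h S = ennreal (density_cdf g a) ^ card S"
    by (simp add: h)
  also have "prod h T = (\<Prod>k\<in>T. ennreal (density_cdf g b - density_cdf g a))"
    using R(3) by (intro prod.cong) (auto simp: h)
  also have "prod h (R - S - T) = (\<Prod>k\<in>R - S - T. ennreal (1 - density_cdf g b))"
    by (intro prod.cong) (auto simp: h)
  finally show ?thesis using F
    by (simp add: h_def ennreal_power ennreal_mult[symmetric] mult_ac
        card_Diff_subset R fin)
qed

text \<open>Given \<open>x i = a\<close> and \<open>x j = b\<close>, the pattern is a condition on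
  each of the other coordinates separately, so their integral splits into a product of probabilities
  of the three regions. The result is the same for all patterns.\<close>

lemma nn_integral_rank_pattern:
  assumes g: "prob_density g" and I: "finite I" "card I = m" and l: "0 < l" "l < u" "u \<le> m"
    and t: "(i, j, S, T) \<in> rank_patterns I l u" and C: "C \<in> sets borel"
  shows "(\<integral>\<^sup>+x. (\<Prod>k\<in>I. ennreal (g (x k))) *
      (if has_rank_pattern I x (i, j, S, T) then indicator C (x i, x j) else 0)
      \<partial>PiM I (\<lambda>_::nat. lborel :: real measure)) =
    (\<integral>\<^sup>+a. \<integral>\<^sup>+b. (if a < b then ennreal (density_cdf g a ^ (l - 1) *
      (density_cdf g b - density_cdf g a) ^ (u - l - 1) *
      (1 - density_cdf g b) ^ (m - u) * g a * g b) * indicator C (a, b) else 0) \<partial>lborel \<partial>lborel)"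
  (is "integral\<^sup>N _ ?f = ?R")
proof -
  note [measurable] = prob_densityD(1)[OF g]
  note g0 = prob_densityD(2)[OF g]
  let ?P = "\<lambda>J. PiM J (\<lambda>_::nat. lborel :: real measure)"
  define R where "R = I - {i, j}"
  have t': "i \<in> I" "j \<in> I" "j \<noteq> i" "S \<subseteq> R" "card S = l - 1" "T \<subseteq> R - S" "card T = u - l - 1"
    using t by (auto simp: rank_patterns_def R_def)
  have R: "I = insert i (insert j R)" "finite R" "i \<notin> R" "j \<notin> R" "i \<notin> insert j R" "finite (insert j R)"
    using t' I by (auto simp: R_def)
  have cR: "card R = m - 2" using I t' by (simp add: R_def card_Diff_subset)
  have "?f \<in> borel_measurable (PiM I (\<lambda>_::nat. borel :: real measure))"
    using borel_measurable_rank_pattern[OF I(1) t'(1,2) C, of S T]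
    by (rule borel_measurable_times_ennreal[rotated]) measurable
  moreover have "sets (?P I) = sets (PiM I (\<lambda>_::nat. borel :: real measure))"
    by (intro sets_PiM_cong) auto
  ultimately have meas: "?f \<in> borel_measurable (?P (insert i (insert j R)))"
    unfolding R(1)[symmetric] by (simp cong: measurable_cong_sets)
  have meas': "(\<lambda>x. ?f (x(i := a))) \<in> borel_measurable (?P (insert j R))" for a
    by (rule measurable_compose[OF _ meas]) (use R in measurable)
  have "integral\<^sup>N (?P I) ?f = (\<integral>\<^sup>+a. \<integral>\<^sup>+b. \<integral>\<^sup>+y. ?f (y(j := b, i := a)) \<partial>?P R \<partial>lborel \<partial>lborel)"
    unfolding R(1) 
    \<comment> \<open>\<open>x i\<close> becomes the outermost variable and \<open>x j\<close> the
      next, so that \<open>a\<close> and \<open>b\<close> are constants for the remaining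
      coordinates.\<close>
    apply (subst lborel_family.product_nn_integral_insert_rev[OF R(6,5)])
     apply (rule meas[unfolded R(1)])
    apply (rule nn_integral_cong)
    apply (rule lborel_family.product_nn_integral_insert_rev[OF R(2,4)])
    apply (rule meas'[unfolded R(1)])
    done
  also have "\<dots> = ?R"
  proof (intro nn_integral_cong)
    fix a b :: real
    have "?f (y(j := b, i := a)) = (if a < b then ennreal (g a) * ennreal (g b) * indicator C (a, b) *
        (\<Prod>k\<in>R. ennreal (g (y k)) * indicator (rank_region S T a b k) (y k)) else 0)" for y :: "nat \<Rightarrow> real"
    proof -
      have 1: "(\<Prod>k\<in>I. ennreal (g ((y(j := b, i := a)) k))) = ennreal (g a) * ennreal (g b) * (\<Prod>k\<in>R. ennreal (g (y k)))"
        unfolding R(1) using R t' 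
        by (subst prod.insert; (subst prod.insert)?) (auto intro!: prod.cong arg_cong2[where f="(*)"] simp: mult.assoc)
      have 2: "has_rank_pattern I (y(j := b, i := a)) (i, j, S, T) \<longleftrightarrow> 
          a < b \<and> (\<forall>k\<in>R. y k \<in> rank_region S T a b k)"
        using t' by (auto simp: has_rank_pattern_def R_def)
      have 3: "(\<Prod>k\<in>R. ennreal (g (y k)) * indicator (rank_region S T a b k) (y k)) = 
         (\<Prod>k\<in>R. ennreal (g (y k))) * (if \<forall>k\<in>R. y k \<in> rank_region S T a b k then 1 else 0)"
        using R by (auto simp: prod.distrib intro!: prod.neutral) 
          (metis (no_types, lifting) indicator_simps(2) prod_zero)
      show ?thesis unfolding 1 2 3 using t' by (auto simp: mult_ac)
    qed
    then have "(\<integral>\<^sup>+y. ?f (y(j := b, i := a)) \<partial>?P R) = (\<integral>\<^sup>+y. (if a < b then ennreal (g a) * ennreal (g b) * indicator C (a, b) *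
        (\<Prod>k\<in>R. ennreal (g (y k)) * indicator (rank_region S T a b k) (y k)) else 0) \<partial>?P R)"
      by simp
    also have "\<dots> = (if a < b then ennreal (density_cdf g a ^ (l - 1) *
      (density_cdf g b - density_cdf g a) ^ (u - l - 1) *
      (1 - density_cdf g b) ^ (m - u) * g a * g b) * indicator C (a, b) else 0)"
    proof (cases "a < b")
      case True
      have F: "0 \<le> density_cdf g a" "0 \<le> density_cdf g b - density_cdf g a" "0 \<le> 1 - density_cdf g b"
        using density_cdf_nonneg density_cdf_mono[OF g, of a b] density_cdf_le_1[OF g] True by auto
      have [measurable]: "rank_region S T a b k \<in> sets borel" for k by (simp add: rank_region_def)
      have "(\<integral>\<^sup>+y. ennreal (g a) * ennreal (g b) * indicator C (a, b) *
          (\<Prod>k\<in>R. ennreal (g (y k)) * indicator (rank_region S T a b k) (y k)) \<partial>?P R) =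
        ennreal (g a) * ennreal (g b) * indicator C (a, b) *
          (\<Prod>k\<in>R. \<integral>\<^sup>+x. ennreal (g x) * indicator (rank_region S T a b k) x \<partial>lborel)"
        using R by (subst nn_integral_cmult)
          (auto intro!: borel_measurable_prod_ennreal arg_cong2[where f="(*)"] lborel_family.product_nn_integral_prod)
      also have "(\<Prod>k\<in>R. \<integral>\<^sup>+x. ennreal (g x) * indicator (rank_region S T a b k) x \<partial>lborel) = 
        ennreal (density_cdf g a ^ (l - 1) * (density_cdf g b - density_cdf g a) ^ (u - l - 1) *
          (1 - density_cdf g b) ^ (m - u))"
        using prod_rank_region[OF g True R(2) t'(4,6)] t'(5,7) cR l by simp
      finally show ?thesis using True F g0
        by (simp add: ennreal_mult[symmetric] mult_ac)
    qed simp
    finally show "(\<integral>\<^sup>+y. ?f (y(j := b, i := a)) \<partial>?P R) = (if a < b then ennreal (density_cdf g a ^ (l - 1) *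
      (density_cdf g b - density_cdf g a) ^ (u - l - 1) *
      (1 - density_cdf g b) ^ (m - u) * g a * g b) * indicator C (a, b) else 0)" .
  qed
  finally show ?thesis .
qed

lemma iid_interval_density_nonneg:
  assumes g: "prob_density g"
  shows "0 \<le> iid_interval_density g m l u a b"
  using density_cdf_nonneg[of g a] density_cdf_mono[OF g, of a b] density_cdf_le_1[OF g, of b]
    prob_densityD(2)[OF g]
  by (auto simp: iid_interval_density_def intro!: mult_nonneg_nonneg divide_nonneg_nonneg)

lemma borel_measurable_iid_interval_density:
  assumes g: "prob_density g"
  shows "(\<lambda>(a, b). iid_interval_density g m l u a b) \<in> borel_measurable (borel \<Otimes>\<^sub>M borel)"
proof -
  note [measurable] = borel_measurable_density_cdf[OF g] prob_densityD(1)[OF g]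
  show ?thesis unfolding iid_interval_density_def by measurable
qed

text \<open>Almost everywhere exactly one pattern occurs, and all patterns contribute the same
  integral. The number of patterns is therefore the normalising constant.\<close>

lemma nn_integral_order_interval:
  assumes g: "prob_density g" and l: "0 < l" "l < u" "u \<le> m" and C: "C \<in> sets borel"
  shows "(\<integral>\<^sup>+x. (\<Prod>k\<in>{1..m}. ennreal (g (x k))) * indicator C (order_interval m l u x)
      \<partial>PiM {1..m} (\<lambda>_. lborel :: real measure)) =
    (\<integral>\<^sup>+a. \<integral>\<^sup>+b. ennreal (iid_interval_density g m l u a b) * indicator C (a, b) \<partial>lborel \<partial>lborel)"
proof -
  note [measurable] = borel_measurable_density_cdf[OF g] prob_densityD(1)[OF g] C
  let ?I = "{1..m}"
  let ?P = "PiM ?I (\<lambda>_. lborel :: real measure)"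
  let ?G = "\<lambda>x. \<Prod>k\<in>?I. ennreal (g (x k))"
  let ?w = "\<lambda>(i, j, S, T) x. if has_rank_pattern ?I x (i, j, S, T) then indicator C (x i, x j) else 0 :: ennreal"
  let ?c = "fact m / (fact (l - 1) * fact (u - l - 1) * fact (m - u)) :: real"
  define D where "D a b = density_cdf g a ^ (l - 1) * (density_cdf g b - density_cdf g a) ^ (u - l - 1) *
      (1 - density_cdf g b) ^ (m - u) * g a * g b" for a b
  define \<D> where "\<D> a b = (if a < b then ennreal (D a b) * indicator C (a, b) else 0)" for a b
  have meas: "(\<lambda>x. ?G x * ?w t x) \<in> borel_measurable ?P" if "t \<in> rank_patterns ?I l u" for t
  proof -
    obtain i j S T where t: "t = (i, j, S, T)" by (cases t)
    have "(\<lambda>x. ?w t x) \<in> borel_measurable (PiM ?I (\<lambda>_. borel :: real measure))"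
      using that borel_measurable_rank_pattern[OF _ _ _ C, of ?I i j S T]
      by (auto simp: t rank_patterns_def)
    then have "(\<lambda>x. ?G x * ?w t x) \<in> borel_measurable (PiM ?I (\<lambda>_. borel :: real measure))"
      by (rule borel_measurable_times_ennreal[rotated]) measurable
    moreover have "sets ?P = sets (PiM ?I (\<lambda>_. borel :: real measure))"
      by (intro sets_PiM_cong) auto
    ultimately show ?thesis by (simp cong: measurable_cong_sets)
  qed
  have "(\<integral>\<^sup>+x. ?G x * indicator C (order_interval m l u x) \<partial>?P) =
      (\<integral>\<^sup>+x. (\<Sum>t\<in>rank_patterns ?I l u. ?G x * ?w t x) \<partial>?P)"
  proof (rule nn_integral_cong_AE)
    show "AE x in ?P. ?G x * indicator C (order_interval m l u x) = (\<Sum>t\<in>rank_patterns ?I l u. ?G x * ?w t x)"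
      using AE_PiM_lborel_inj_on[of ?I, simplified]
    proof eventually_elim
      \<comment> \<open>\<open>simplified\<close> has rewritten the lower bound 1 of the index set
        to \<open>Suc 0\<close>.\<close>
      fix x :: "nat \<Rightarrow> real" assume "inj_on x {Suc 0..m}"
      then have "inj_on x ?I" by simp
      from ex1_rank_pattern[OF this l] obtain i j S T
        where x: "order_interval m l u x = (x i, x j)"
          "{t \<in> rank_patterns ?I l u. has_rank_pattern ?I x t} = {(i, j, S, T)}" by blast
      then have p: "has_rank_pattern ?I x (i, j, S, T)" "(i, j, S, T) \<in> rank_patterns ?I l u" by blast+
      have "(\<Sum>t\<in>rank_patterns ?I l u. ?G x * ?w t x) = (\<Sum>t\<in>{(i, j, S, T)}. ?G x * ?w t x)"
      proof (rule sum.mono_neutral_right)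
        show "\<forall>t\<in>rank_patterns ?I l u - {(i, j, S, T)}. ?G x * ?w t x = 0"
        proof
          fix t assume t: "t \<in> rank_patterns ?I l u - {(i, j, S, T)}"
          then have "\<not> has_rank_pattern ?I x t" using x(2) by blast
          then show "?G x * ?w t x = 0" by (cases t) simp
        qed
      qed (use p in \<open>auto intro: finite_rank_patterns\<close>)
      then show "?G x * indicator C (order_interval m l u x) = (\<Sum>t\<in>rank_patterns ?I l u. ?G x * ?w t x)"
        using p x(1) by simp
    qed
  qed
  also have "\<dots> = (\<Sum>t\<in>rank_patterns ?I l u. \<integral>\<^sup>+x. ?G x * ?w t x \<partial>?P)"
    by (rule nn_integral_sum) (rule meas)
  also have "\<dots> = (\<Sum>t\<in>rank_patterns ?I l u. \<integral>\<^sup>+a. \<integral>\<^sup>+b. \<D> a b \<partial>lborel \<partial>lborel)"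
  proof (rule sum.cong[OF refl])
    fix t assume t: "t \<in> rank_patterns ?I l u"
    obtain i j S T where t': "t = (i, j, S, T)" by (cases t)
    show "(\<integral>\<^sup>+x. ?G x * ?w t x \<partial>?P) = (\<integral>\<^sup>+a. \<integral>\<^sup>+b. \<D> a b \<partial>lborel \<partial>lborel)"
      using nn_integral_rank_pattern[OF g _ _ l t[unfolded t'] C] unfolding t' prod.case \<D>_def D_def
      by (simp del: atLeastAtMost_iff)
  qed
  also have "\<dots> = ennreal ?c * (\<integral>\<^sup>+a. \<integral>\<^sup>+b. \<D> a b \<partial>lborel \<partial>lborel)"
    using card_rank_patterns[of ?I m l u] l by (simp add: ennreal_of_nat_eq_real_of_nat)
  also have "\<dots> = (\<integral>\<^sup>+a. \<integral>\<^sup>+b. ennreal ?c * \<D> a b \<partial>lborel \<partial>lborel)"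
    unfolding \<D>_def D_def
    by (subst nn_integral_cmult[symmetric], measurable, intro nn_integral_cong, subst nn_integral_cmult[symmetric], measurable)
  \<comment> \<open>The patterns require \<open>a < b\<close>, whereas
    \<open>iid_interval_density\<close> is given by the formula for \<open>a \<le> b\<close>; for
    fixed \<open>a\<close> the difference is a single null point.\<close>
  also have "\<dots> = (\<integral>\<^sup>+a. \<integral>\<^sup>+b. ennreal (iid_interval_density g m l u a b) * indicator C (a, b) \<partial>lborel \<partial>lborel)"
  proof (rule nn_integral_cong, rule nn_integral_cong_AE)
    fix a :: real
    show "AE b in lborel. ennreal ?c * \<D> a b = ennreal (iid_interval_density g m l u a b) * indicator C (a, b)"
      using AE_lborel_singleton[of a]
    proof eventually_elim
      fix b assume "b \<noteq> a"
      show "ennreal ?c * \<D> a b = ennreal (iid_interval_density g m l u a b) * indicator C (a, b)"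
      proof (cases "a < b")
        case True
        then have 1: "iid_interval_density g m l u a b = ?c * D a b"
          by (simp add: iid_interval_density_def D_def)
        have "ennreal (?c * D a b) = ennreal ?c * ennreal (D a b)"
          by (rule ennreal_mult') simp
        then show ?thesis using True unfolding 1 by (simp add: \<D>_def mult.assoc)
      qed (use \<open>b \<noteq> a\<close> in \<open>simp add: \<D>_def iid_interval_density_def\<close>)
    qed
  qed
  finally show ?thesis .
qed

section \<open>Measurability of order statistics, ties included\<close>

lemma order_stat_le_iff:
  assumes "1 \<le> k" "k \<le> m"
  shows "order_stat m k x \<le> c \<longleftrightarrow> (\<exists>J\<subseteq>{1..m}. card J = k \<and> (\<forall>j\<in>J. x j \<le> c))"
proof -
  define ys where "ys = sort (map x [1..<Suc m])"
  have ys: "sorted ys" "length ys = m" by (auto simp: ys_def simp del: upt_Suc)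
  have "length (filter (\<lambda>y. y \<le> c) ys) = length (filter (\<lambda>y. y \<le> c) (map x [1..<Suc m]))"
    by (simp add: ys_def filter_sort del: upt_Suc)
  also have "\<dots> = card {j\<in>{1..m}. x j \<le> c}"
    by (simp add: filter_map distinct_length_filter o_def atLeastLessThanSuc_atLeastAtMost Int_def conj_commute del: upt_Suc)
  finally have len: "length (filter (\<lambda>y. y \<le> c) ys) = card {j\<in>{1..m}. x j \<le> c}" .
  \<comment> \<open>In a sorted list the entries that are at most \<open>c\<close> form an initial
    segment, and position k - 1 belongs to it exactly when its length is at least k.\<close>
  have "ys ! (k - 1) \<le> c \<longleftrightarrow> k \<le> length (filter (\<lambda>y. y \<le> c) ys)"
  proof
    assume "ys ! (k - 1) \<le> c"
    moreover have "ys ! i \<le> ys ! (k - 1)" if "i < k" for i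
      using that ys assms by (intro sorted_nth_mono) auto
    ultimately have "{..<k} \<subseteq> {i. i < length ys \<and> ys ! i \<le> c}"
      using ys assms by (auto intro: order_trans)
    then have "card {..<k} \<le> card {i. i < length ys \<and> ys ! i \<le> c}" by (intro card_mono) auto
    then show "k \<le> length (filter (\<lambda>y. y \<le> c) ys)" by (simp add: length_filter_conv_card)
  next
    assume a: "k \<le> length (filter (\<lambda>y. y \<le> c) ys)"
    show "ys ! (k - 1) \<le> c"
    proof (rule ccontr)
      assume b: "\<not> ys ! (k - 1) \<le> c"
      have "{i. i < length ys \<and> ys ! i \<le> c} \<subseteq> {..<k - 1}"
      proof
        fix i assume i: "i \<in> {i. i < length ys \<and> ys ! i \<le> c}"
        show "i \<in> {..<k - 1}"
        proof (rule ccontr)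
          assume "i \<notin> {..<k - 1}"
          then have "ys ! (k - 1) \<le> ys ! i" using i ys by (intro sorted_nth_mono) auto
          then show False using b i by auto
        qed
      qed
      then have "card {i. i < length ys \<and> ys ! i \<le> c} \<le> card {..<k - 1}" by (intro card_mono) auto
      then show False using a assms by (simp add: length_filter_conv_card)
    qed
  qed
  also have "\<dots> \<longleftrightarrow> (\<exists>J\<subseteq>{1..m}. card J = k \<and> (\<forall>j\<in>J. x j \<le> c))"
    unfolding len
  proof
    assume "k \<le> card {j \<in> {1..m}. x j \<le> c}"
    then obtain J where "J \<subseteq> {j \<in> {1..m}. x j \<le> c}" "card J = k"
      by (meson obtain_subset_with_card_n)
    then show "\<exists>J\<subseteq>{1..m}. card J = k \<and> (\<forall>j\<in>J. x j \<le> c)" by (intro exI[of _ J]) auto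
  next
    assume "\<exists>J\<subseteq>{1..m}. card J = k \<and> (\<forall>j\<in>J. x j \<le> c)"
    then obtain J where "J \<subseteq> {j \<in> {1..m}. x j \<le> c}" "card J = k" by blast
    then show "k \<le> card {j \<in> {1..m}. x j \<le> c}" using card_mono[of "{j \<in> {1..m}. x j \<le> c}" J] by simp
  qed
  finally show ?thesis by (simp add: order_stat_def ys_def)
qed

text \<open>By \<open>order_stat_le_iff\<close>, the event that the order statistic is at most
  \<open>c\<close> is a finite union of finite intersections of events about single
  variables.\<close>

lemma borel_measurable_order_stat:
  assumes k: "1 \<le> k" "k \<le> m" and X: "\<And>i. i \<in> {1..m} \<Longrightarrow> X i \<in> borel_measurable M"
  shows "(\<lambda>\<omega>. order_stat m k (\<lambda>i. X i \<omega>)) \<in> borel_measurable M"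
proof (rule borel_measurableI_le)
  fix c
  have [measurable]: "Measurable.pred M (\<lambda>\<omega>. X j \<omega> \<le> c)" if "j \<in> {1..m}" for j
    using X[OF that] by measurable
  have "{\<omega> \<in> space M. order_stat m k (\<lambda>i. X i \<omega>) \<le> c} =
    {\<omega> \<in> space M. \<exists>J\<in>{J. J \<subseteq> {1..m} \<and> card J = k}. \<forall>j\<in>J. X j \<omega> \<le> c}"
    using order_stat_le_iff[OF k] by auto
  also have "\<dots> \<in> sets M"
  proof (intro sets.sets_Collect_finite_Ex sets.sets_Collect_finite_All)
    show "finite {J. J \<subseteq> {1..m} \<and> card J = k}" by simp
    show "finite J" if "J \<in> {J. J \<subseteq> {1..m} \<and> card J = k}" for J
      using that by (auto intro: finite_subset)
    show "{\<omega> \<in> space M. X j \<omega> \<le> c} \<in> sets M" if "J \<in> {J. J \<subseteq> {1..m} \<and> card J = k}" "j \<in> J" for J j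
      using X[of j] that by auto
  qed
  finally show "{\<omega> \<in> space M. order_stat m k (\<lambda>i. X i \<omega>) \<le> c} \<in> sets M" .
qed

lemma measurable_order_interval:
  assumes "0 < l" "l < u" "u \<le> m" and X: "\<And>i. i \<in> {1..m} \<Longrightarrow> X i \<in> borel_measurable M"
  shows "(\<lambda>\<omega>. order_interval m l u (\<lambda>i. X i \<omega>)) \<in> borel_measurable M"
  unfolding order_interval_def using assms
  by (intro borel_measurable_Pair borel_measurable_order_stat) auto

section \<open>Conditionally i.i.d. samples from a location-scale family\<close>

lemma order_interval_cong:
  assumes "\<And>i. i \<in> {1..m} \<Longrightarrow> x i = y i"
  shows "order_interval m l u x = order_interval m l u y"
proof -
  have "map x [1..<Suc m] = map y [1..<Suc m]"
    using assms by (intro map_cong) auto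
  then show ?thesis unfolding order_interval_def order_stat_def by (simp only:)
qed

text \<open>\<open>cond_iid\<close> fixes the joint law on rectangles only; these generate the
  product sigma-algebra and are closed under intersection, which extends the identity to every
  \<open>B\<close>. The function \<open>g\<close> is a jointly measurable version of
  \<open>f\<close>: nothing is known about \<open>f\<close> outside \<open>param_space\<close>, but
  in the application \<open>w\<close> vanishes there.\<close>

lemma emeasure_cond_iid:
  fixes w :: "real \<times> real \<Rightarrow> ennreal" and g :: "real \<times> real \<Rightarrow> real \<Rightarrow> real"
  assumes M: "prob_space M" and \<Theta>: "distributed M lborel \<Theta> w" and X: "cond_iid M \<Theta> f X"
    and g[measurable]: "case_prod g \<in> borel_measurable (borel \<Otimes>\<^sub>M borel)"
    and fg: "\<And>\<theta>. w \<theta> \<noteq> 0 \<Longrightarrow> f \<theta> = g \<theta>"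
    and B: "B \<in> sets (PiM {1..m} (\<lambda>_. borel))"
  shows "emeasure M {\<omega> \<in> space M. (\<lambda>i\<in>{1..m}. X i \<omega>) \<in> B} =
    (\<integral>\<^sup>+\<theta>. w \<theta> * (\<integral>\<^sup>+x. (\<Prod>k\<in>{1..m}. ennreal (g \<theta> (x k))) * indicator B x
      \<partial>PiM {1..m} (\<lambda>_. lborel :: real measure)) \<partial>lborel)"
proof -
  interpret prob_space M by fact
  define I where "I = {1..m}"
  have [simp]: "finite I" by (simp add: I_def)
  let ?L = "PiM I (\<lambda>_. lborel :: real measure)" and ?B = "PiM I (\<lambda>_. borel :: real measure)"
  interpret L: sigma_finite_measure ?L by (rule lborel_family.sigma_finite) simp
  have [measurable]: "w \<in> borel_measurable borel" using distributed_borel_measurable[OF \<Theta>] by simp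
  have X_meas: "X i \<in> borel_measurable M" if "i \<in> I" for i
    using X that by (auto simp: cond_iid_def I_def)
  have [measurable]: "(\<lambda>\<omega>. \<lambda>i\<in>I. X i \<omega>) \<in> measurable M ?B"
    using X_meas by (intro measurable_restrict) auto
  have [measurable_cong]: "sets ?L = sets ?B" by (intro sets_PiM_cong) auto
  have [measurable]: "(\<lambda>z. (\<Prod>k\<in>I. ennreal (g (fst z) (snd z k)))) \<in> borel_measurable (lborel \<Otimes>\<^sub>M ?B)"
  proof (intro borel_measurable_prod_ennreal)
    fix k assume "k \<in> I"
    then have [measurable]: "(\<lambda>z. snd z k) \<in> borel_measurable ((lborel :: (real \<times> real) measure) \<Otimes>\<^sub>M ?B)"
      by (intro measurable_compose[OF measurable_snd]) measurable
    have "(\<lambda>z. (fst z, snd z k)) \<in> measurable ((lborel :: (real \<times> real) measure) \<Otimes>\<^sub>M ?B) (borel \<Otimes>\<^sub>M borel)"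
      by measurable
    from measurable_compose[OF this g]
    have [measurable]: "(\<lambda>z. g (fst z) (snd z k)) \<in> borel_measurable ((lborel :: (real \<times> real) measure) \<Otimes>\<^sub>M ?B)"
      by simp
    show "(\<lambda>z. ennreal (g (fst z) (snd z k))) \<in> borel_measurable ((lborel :: (real \<times> real) measure) \<Otimes>\<^sub>M ?B)"
      by measurable
  qed
  \<comment> \<open>\<open>P1\<close> is the law of the sample and \<open>P2\<close> the mixture
    over the parameter, written as the marginal of a joint density so that it is a measure by
    construction.\<close>
  define P1 where "P1 = distr M ?B (\<lambda>\<omega>. \<lambda>i\<in>I. X i \<omega>)"
  define P2 where "P2 = distr (density (lborel \<Otimes>\<^sub>M ?L) (\<lambda>z. w (fst z) * (\<Prod>k\<in>I. ennreal (g (fst z) (snd z k))))) ?B snd"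
  have P2: "emeasure P2 A = (\<integral>\<^sup>+\<theta>. w \<theta> * (\<integral>\<^sup>+x. (\<Prod>k\<in>I. ennreal (g \<theta> (x k))) * indicator A x \<partial>?L) \<partial>lborel)"
    if A[measurable]: "A \<in> sets ?B" for A
  proof -
    have "emeasure P2 A = (\<integral>\<^sup>+z. w (fst z) * (\<Prod>k\<in>I. ennreal (g (fst z) (snd z k))) * indicator A (snd z) \<partial>(lborel \<Otimes>\<^sub>M ?L))"
    proof -
      let ?D = "density (lborel \<Otimes>\<^sub>M ?L) (\<lambda>z. w (fst z) * (\<Prod>k\<in>I. ennreal (g (fst z) (snd z k))))"
      have "emeasure P2 A = (\<integral>\<^sup>+x. indicator A x \<partial>P2)" using A by (simp add: P2_def)
      also have "\<dots> = (\<integral>\<^sup>+z. indicator A (snd z) \<partial>?D)"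
        unfolding P2_def by (rule nn_integral_distr) measurable
      also have "\<dots> = (\<integral>\<^sup>+z. w (fst z) * (\<Prod>k\<in>I. ennreal (g (fst z) (snd z k))) * indicator A (snd z) \<partial>(lborel \<Otimes>\<^sub>M ?L))"
        by (rule nn_integral_density) measurable
      finally show ?thesis .
    qed
    also have "\<dots> = (\<integral>\<^sup>+\<theta>. \<integral>\<^sup>+x. w \<theta> * (\<Prod>k\<in>I. ennreal (g \<theta> (x k))) * indicator A x \<partial>?L \<partial>lborel)"
      by (subst L.nn_integral_fst[symmetric]) (auto simp: split_beta')
    also have "\<dots> = (\<integral>\<^sup>+\<theta>. w \<theta> * (\<integral>\<^sup>+x. (\<Prod>k\<in>I. ennreal (g \<theta> (x k))) * indicator A x \<partial>?L) \<partial>lborel)"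
    proof (rule nn_integral_cong)
      fix \<theta>
      have [measurable]: "g \<theta> \<in> borel_measurable borel"
        using measurable_compose[OF measurable_Pair1' g, of \<theta>] by simp
      show "(\<integral>\<^sup>+x. w \<theta> * (\<Prod>k\<in>I. ennreal (g \<theta> (x k))) * indicator A x \<partial>?L) =
        w \<theta> * (\<integral>\<^sup>+x. (\<Prod>k\<in>I. ennreal (g \<theta> (x k))) * indicator A x \<partial>?L)"
        by (subst nn_integral_cmult[symmetric]) (auto simp: mult.assoc)
    qed
    finally show ?thesis .
  qed
  have P1: "emeasure P1 A = emeasure M {\<omega> \<in> space M. (\<lambda>i\<in>I. X i \<omega>) \<in> A}" if "A \<in> sets ?B" for A
    unfolding P1_def using that 
    by (subst emeasure_distr) (auto intro!: arg_cong[where f="emeasure M"])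
  have "P1 = P2"
  proof (rule measure_eqI_PiM_finite[where I = I and M = "\<lambda>_. borel :: real measure"])
    fix A :: "nat \<Rightarrow> real set" assume A: "\<And>i. i \<in> I \<Longrightarrow> A i \<in> sets borel"
    have sA: "PiE I A \<in> sets ?B" using A by (intro sets_PiM_I_finite) auto
    have "emeasure P1 (PiE I A) = emeasure M {\<omega> \<in> space M. \<Theta> \<omega> \<in> UNIV \<and> (\<forall>i\<in>I. X i \<omega> \<in> A i)}"
      unfolding P1[OF sA] by (intro arg_cong[where f="emeasure M"]) (auto simp: PiE_iff)
    also have "\<dots> = (\<integral>\<^sup>+\<theta>\<in>UNIV. (\<Prod>i\<in>I. \<integral>\<^sup>+x\<in>A i. ennreal (f \<theta> x) \<partial>lborel) \<partial>distr M borel \<Theta>)"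
    proof -
      have "\<forall>A B. A \<in> sets borel \<longrightarrow> (\<forall>i\<in>I. B i \<in> sets borel) \<longrightarrow>
        emeasure M {\<omega> \<in> space M. \<Theta> \<omega> \<in> A \<and> (\<forall>i\<in>I. X i \<omega> \<in> B i)} =
        (\<integral>\<^sup>+\<theta>\<in>A. (\<Prod>i\<in>I. \<integral>\<^sup>+x\<in>B i. ennreal (f \<theta> x) \<partial>lborel) \<partial>distr M borel \<Theta>)"
        using X unfolding cond_iid_def I_def by blast
      then show ?thesis using A by (elim allE[of _ UNIV] allE[of _ A]) auto
    qed
    also have "distr M borel \<Theta> = density lborel w"
      using distributed_distr_eq_density[OF \<Theta>] by (metis distr_cong sets_lborel)
    also have "(\<integral>\<^sup>+\<theta>\<in>UNIV. (\<Prod>i\<in>I. \<integral>\<^sup>+x\<in>A i. ennreal (f \<theta> x) \<partial>lborel) \<partial>density lborel w) =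
        (\<integral>\<^sup>+\<theta>. (\<Prod>i\<in>I. \<integral>\<^sup>+x\<in>A i. ennreal (g \<theta> x) \<partial>lborel) \<partial>density lborel w)"
    proof (rule nn_integral_cong_AE)
      show "AE \<theta> in density lborel w. (\<Prod>i\<in>I. \<integral>\<^sup>+x\<in>A i. ennreal (f \<theta> x) \<partial>lborel) * indicator UNIV \<theta> =
        (\<Prod>i\<in>I. \<integral>\<^sup>+x\<in>A i. ennreal (g \<theta> x) \<partial>lborel)"
        by (subst AE_density) (auto simp: fg)
    qed
    also have "\<dots> = (\<integral>\<^sup>+\<theta>. w \<theta> * (\<Prod>i\<in>I. \<integral>\<^sup>+x\<in>A i. ennreal (g \<theta> x) \<partial>lborel) \<partial>lborel)"
    proof (subst nn_integral_density)
      show "(\<lambda>\<theta>. \<Prod>i\<in>I. \<integral>\<^sup>+x\<in>A i. ennreal (g \<theta> x) \<partial>lborel) \<in> borel_measurable lborel"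
      proof (intro borel_measurable_prod_ennreal)
        fix i assume "i \<in> I"
        with A have [measurable]: "A i \<in> sets borel" by simp
        show "(\<lambda>\<theta>. \<integral>\<^sup>+x\<in>A i. ennreal (g \<theta> x) \<partial>lborel) \<in> borel_measurable lborel"
          by measurable
      qed
    qed auto
    also have "\<dots> = emeasure P2 (PiE I A)"
      unfolding P2[OF sA]
    proof (intro nn_integral_cong arg_cong2[where f="(*)"] refl)
      fix \<theta>
      have [measurable]: "g \<theta> \<in> borel_measurable borel"
        using measurable_compose[OF measurable_Pair1' g, of \<theta>] by simp
      have "(\<integral>\<^sup>+x. (\<Prod>k\<in>I. ennreal (g \<theta> (x k))) * indicator (PiE I A) x \<partial>?L) = 
        (\<integral>\<^sup>+x. (\<Prod>k\<in>I. ennreal (g \<theta> (x k)) * indicator (A k) (x k)) \<partial>?L)"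
      proof (rule nn_integral_cong)
        fix x assume x: "x \<in> space ?L"
        show "(\<Prod>k\<in>I. ennreal (g \<theta> (x k))) * indicator (PiE I A) x = (\<Prod>k\<in>I. ennreal (g \<theta> (x k)) * indicator (A k) (x k))"
        proof (cases "x \<in> PiE I A")
          case True
          then have "x k \<in> A k" if "k \<in> I" for k using that by auto
          then show ?thesis using True by (auto intro!: prod.cong)
        next
          case False
          then obtain k where "k \<in> I" "x k \<notin> A k" using x by (auto simp: PiE_iff space_PiM)
          then have "(\<Prod>k\<in>I. ennreal (g \<theta> (x k)) * indicator (A k) (x k)) = 0"
            by (intro prod_zero) (auto intro!: bexI[of _ k])
          then show ?thesis using False by simp
        qed
      qed
      also have "\<dots> = (\<Prod>k\<in>I. \<integral>\<^sup>+x. ennreal (g \<theta> x) * indicator (A k) x \<partial>lborel)"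
        using A by (intro lborel_family.product_nn_integral_prod) auto
      finally show "(\<Prod>k\<in>I. \<integral>\<^sup>+x. ennreal (g \<theta> x) * indicator (A k) x \<partial>lborel) =
        (\<integral>\<^sup>+x. (\<Prod>k\<in>I. ennreal (g \<theta> (x k))) * indicator (PiE I A) x \<partial>?L)" ..
    qed
    finally show "emeasure P1 (PiE I A) = emeasure P2 (PiE I A)" .
  next
    show "range (\<lambda>n::nat. space ?B) \<subseteq> prod_algebra I (\<lambda>_. borel)"
      by (auto simp: space_PiM intro!: prod_algebraI_finite)
    show "emeasure P1 (space ?B) \<noteq> \<infinity>" by (subst P1) auto
  qed (auto simp: P1_def P2_def)
  note B' = B[folded I_def]
  show ?thesis
    unfolding I_def[symmetric] P1[OF B', symmetric] P2[OF B', symmetric] \<open>P1 = P2\<close> ..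
qed

text \<open>Outside \<open>P\<close> the function \<open>\<pi>\<close> is arbitrary, and
  \<open>ennreal\<close> cuts off negative values; on \<open>P\<close> it is nonnegative, so
  \<open>enn2real\<close> recovers it without loss.\<close>

lemma borel_measurable_indicator_mult:
  assumes w: "(\<lambda>\<theta>. ennreal (\<pi> \<theta>) * indicator P \<theta>) \<in> borel_measurable M"
    and \<pi>0: "\<And>\<theta>. \<theta> \<in> P \<Longrightarrow> 0 \<le> \<pi> \<theta>"
  shows "(\<lambda>\<theta>. indicator P \<theta> * \<pi> \<theta> :: real) \<in> borel_measurable M"
proof -
  have "(\<lambda>\<theta>. enn2real (ennreal (\<pi> \<theta>) * indicator P \<theta>)) \<in> borel_measurable M"
    using w by measurable
  also have "(\<lambda>\<theta>. enn2real (ennreal (\<pi> \<theta>) * indicator P \<theta>)) = (\<lambda>\<theta>. indicator P \<theta> * \<pi> \<theta>)"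
    using \<pi>0 by (auto simp: fun_eq_iff indicator_def)
  finally show ?thesis .
qed

text \<open>Fixes the standard density whose existence \<open>location_scale_density\<close>
  asserts, so that statements about \<open>f\<close> reduce to statements about
  \<open>f0\<close>.\<close>

locale location_scale_family =
  fixes f :: "real \<times> real \<Rightarrow> real \<Rightarrow> real" and f0 :: "real \<Rightarrow> real"
  assumes f0: "prob_density f0"
    and f_eq: "0 < \<tau> \<Longrightarrow> f (\<mu>, \<tau>) x = f0 ((x - \<mu>) / \<tau>) / \<tau>"
begin

lemma f_eq': "\<theta> \<in> param_space \<Longrightarrow> f \<theta> x = f0 ((x - fst \<theta>) / snd \<theta>) / snd \<theta>"
  using f_eq[of "snd \<theta>" "fst \<theta>" x] by (auto simp: param_space_def)

lemma nn_integral_location_scale: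
  assumes \<theta>: "\<theta> \<in> param_space" and A: "A \<in> sets borel"
  shows "(\<integral>\<^sup>+x. ennreal (f \<theta> x) * indicator A x \<partial>lborel) =
    (\<integral>\<^sup>+z. ennreal (f0 z) * indicator A (fst \<theta> + snd \<theta> * z) \<partial>lborel)"
proof -
  note [measurable] = prob_densityD(1)[OF f0] A
  have \<tau>: "0 < snd \<theta>" using \<theta> by (auto simp: param_space_def)
  have "(\<integral>\<^sup>+x. ennreal (f \<theta> x) * indicator A x \<partial>lborel) =
    (\<integral>\<^sup>+x. ennreal (f0 ((x - fst \<theta>) / snd \<theta>) / snd \<theta>) * indicator A x \<partial>lborel)"
    using \<theta> by (simp add: f_eq')
  also have "\<dots> = ennreal (snd \<theta>) *
      (\<integral>\<^sup>+z. ennreal (f0 z / snd \<theta>) * indicator A (fst \<theta> + snd \<theta> * z) \<partial>lborel)"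
    using \<tau> by (subst nn_integral_real_affine[where c="snd \<theta>" and t="fst \<theta>"]) auto
  also have "\<dots> = (\<integral>\<^sup>+z. ennreal (snd \<theta>) * (ennreal (f0 z / snd \<theta>) * indicator A (fst \<theta> + snd \<theta> * z)) \<partial>lborel)"
    by (subst nn_integral_cmult) auto
  also have "\<dots> = (\<integral>\<^sup>+z. ennreal (f0 z) * indicator A (fst \<theta> + snd \<theta> * z) \<partial>lborel)"
    using \<tau> prob_densityD(2)[OF f0]
    by (intro nn_integral_cong) (simp add: mult.assoc[symmetric] ennreal_mult[symmetric])
  finally show ?thesis .
qed

lemma prob_density_f:
  assumes \<theta>: "\<theta> \<in> param_space"
  shows "prob_density (f \<theta>)"
  unfolding prob_density_def
proof (intro conjI allI)
  note [measurable] = prob_densityD(1)[OF f0]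
  have \<tau>: "0 < snd \<theta>" using \<theta> by (auto simp: param_space_def)
  have "f \<theta> = (\<lambda>x. f0 ((x - fst \<theta>) / snd \<theta>) / snd \<theta>)" using f_eq'[OF \<theta>] by auto
  then show "f \<theta> \<in> borel_measurable borel" by simp
  show "0 \<le> f \<theta> x" for x using prob_densityD(2)[OF f0] \<tau> by (simp add: f_eq'[OF \<theta>])
  show "(\<integral>\<^sup>+x. ennreal (f \<theta> x) \<partial>lborel) = 1"
    using nn_integral_location_scale[OF \<theta>, of UNIV] prob_densityD(3)[OF f0] by simp
qed

lemma density_cdf_f:
  assumes \<theta>: "\<theta> \<in> param_space"
  shows "density_cdf (f \<theta>) x = density_cdf f0 ((x - fst \<theta>) / snd \<theta>)"
proof -
  have \<tau>: "0 < snd \<theta>" using \<theta> by (auto simp: param_space_def)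
  have "ennreal (density_cdf (f \<theta>) x) = (\<integral>\<^sup>+z. ennreal (f0 z) * indicator {..<x} (fst \<theta> + snd \<theta> * z) \<partial>lborel)"
    unfolding nn_integral_density_less[OF prob_density_f[OF \<theta>], symmetric]
    by (rule nn_integral_location_scale[OF \<theta>]) simp
  also have "\<dots> = (\<integral>\<^sup>+z. ennreal (f0 z) * indicator {..<(x - fst \<theta>) / snd \<theta>} z \<partial>lborel)"
    using \<tau> by (intro nn_integral_cong) (auto simp: indicator_def field_simps)
  also have "\<dots> = ennreal (density_cdf f0 ((x - fst \<theta>) / snd \<theta>))"
    by (rule nn_integral_density_less[OF f0])
  finally show ?thesis by (simp add: density_cdf_nonneg)
qed

text \<open>The cdf factors are invariant under standardisation, and each of the two density factors
  contributes 1 / \<tau>.\<close>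

lemma iid_interval_density_f:
  assumes \<theta>: "\<theta> \<in> param_space"
  shows "iid_interval_density (f \<theta>) m l u x x' =
    iid_interval_density f0 m l u ((x - fst \<theta>) / snd \<theta>) ((x' - fst \<theta>) / snd \<theta>) / (snd \<theta>)\<^sup>2"
proof -
  have \<tau>: "0 < snd \<theta>" using \<theta> by (auto simp: param_space_def)
  then have "(x - fst \<theta>) / snd \<theta> \<le> (x' - fst \<theta>) / snd \<theta> \<longleftrightarrow> x \<le> x'"
    by (simp add: divide_le_cancel)
  then show ?thesis
    by (simp add: iid_interval_density_def density_cdf_f[OF \<theta>] f_eq'[OF \<theta>] power2_eq_square)
qed

lemma borel_measurable_iid_interval_density_f:
  "(\<lambda>(\<theta>, x, x'). indicator param_space \<theta> * iid_interval_density (f \<theta>) m l u x x')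
    \<in> borel_measurable (borel \<Otimes>\<^sub>M (borel \<Otimes>\<^sub>M borel))"
proof -
  note [measurable] = borel_measurable_iid_interval_density[OF f0]
  have [measurable]: "param_space \<in> sets (borel \<Otimes>\<^sub>M borel)"
    by (simp add: param_space_def)
  have "(\<lambda>(\<theta>, x, x'). indicator param_space \<theta> * iid_interval_density (f \<theta>) m l u x x') =
    (\<lambda>(\<theta>, x, x'). indicator param_space \<theta> *
      ((\<lambda>(a, b). iid_interval_density f0 m l u a b) ((x - fst \<theta>) / snd \<theta>, (x' - fst \<theta>) / snd \<theta>) / (snd \<theta>)\<^sup>2))"
    by (auto simp: fun_eq_iff iid_interval_density_f indicator_def)
  also have "\<dots> \<in> borel_measurable ((borel \<Otimes>\<^sub>M borel) \<Otimes>\<^sub>M (borel \<Otimes>\<^sub>M borel))"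
    by measurable
  also have "((borel \<Otimes>\<^sub>M borel) \<Otimes>\<^sub>M (borel \<Otimes>\<^sub>M borel)) =
      (borel :: (real \<times> real) measure) \<Otimes>\<^sub>M (borel \<Otimes>\<^sub>M (borel :: real measure))"
    by (simp only: borel_prod)
  finally show ?thesis .
qed

text \<open>The law of the interval is a mixture, and Tonelli gives its density as a nonnegative
  integral over \<theta>, whereas \<open>interval_density\<close> is a Bochner integral, with value
  0 in case of divergence. Finiteness makes the two agree for x < x'; for x > x' both are 0, and the
  diagonal is a null set.\<close>

lemma distributed_order_interval:
  assumes M: "prob_space M" and \<Theta>: "distributed M lborel \<Theta> (\<lambda>\<theta>. ennreal (\<pi> \<theta>) * indicator param_space \<theta>)"
    and X: "cond_iid M \<Theta> f X" and l: "0 < l" "l < u" "u \<le> m"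
    and \<pi>0: "\<And>\<theta>. \<theta> \<in> param_space \<Longrightarrow> 0 \<le> \<pi> \<theta>"
    and fin: "\<And>x x'. x < x' \<Longrightarrow>
      (\<integral>\<^sup>+\<theta>\<in>param_space. ennreal (\<bar>iid_interval_density (f \<theta>) m l u x x'\<bar> * \<pi> \<theta>) \<partial>lborel) < \<infinity>"
  shows "distributed M lborel (\<lambda>\<omega>. order_interval m l u (\<lambda>i. X i \<omega>))
    (\<lambda>(x, x'). ennreal (interval_density f \<pi> m l u x x'))"
proof -
  let ?w = "\<lambda>\<theta>. ennreal (\<pi> \<theta>) * indicator param_space \<theta>"
  have w[measurable]: "?w \<in> borel_measurable borel" using distributed_borel_measurable[OF \<Theta>] by simp
  note [measurable] = borel_measurable_indicator_mult[OF w \<pi>0]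
  \<comment> \<open>Each of the two factors carries its own indicator, since neither is known to be
    measurable beyond \<open>param_space\<close>.\<close>
  define k where "k \<theta> z = (indicator param_space \<theta> * iid_interval_density (f \<theta>) m l u (fst z) (snd z)) *
    (indicator param_space \<theta> * \<pi> \<theta>)" for \<theta> z
  have k_meas[measurable]: "(\<lambda>(\<theta>, z). k \<theta> z) \<in> borel_measurable (borel \<Otimes>\<^sub>M borel)"
  proof -
    have "(\<lambda>z. indicator param_space (fst z) * iid_interval_density (f (fst z)) m l u (fst (snd z)) (snd (snd z)))
        \<in> borel_measurable (borel \<Otimes>\<^sub>M borel)"
      using borel_measurable_iid_interval_density_f[of m l u] by (simp only: borel_prod split_beta')
    from borel_measurable_times[OF this measurable_compose[OF measurable_fst borel_measurable_indicator_mult[OF w \<pi>0]]]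
    show ?thesis by (simp add: k_def split_beta')
  qed
  have k_nonneg: "0 \<le> k \<theta> z" for \<theta> z
    using iid_interval_density_nonneg[OF prob_density_f] \<pi>0 by (auto simp: k_def indicator_def)
  have dens: "interval_density f \<pi> m l u (fst z) (snd z) = (\<integral>\<theta>. k \<theta> z \<partial>lborel)" for z
    unfolding interval_density_def set_lebesgue_integral_def k_def
    by (intro Bochner_Integration.integral_cong) (auto simp: indicator_def)
  have dens_meas[measurable]: "(\<lambda>z. ennreal (\<integral>\<theta>. k \<theta> z \<partial>lborel)) \<in> borel_measurable borel"
  proof -
    have "(\<lambda>(z, \<theta>). k \<theta> z) \<in> borel_measurable (borel \<Otimes>\<^sub>M lborel)"
      using measurable_pair_swap[OF k_meas] by simp
    then have "(\<lambda>z. \<integral>\<theta>. k \<theta> z \<partial>lborel) \<in> borel_measurable borel"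
      by (rule lborel.borel_measurable_lebesgue_integral)
    then show ?thesis by measurable
  qed
  have X_meas: "X i \<in> borel_measurable M" if "i \<in> {1..m}" for i
    using X that by (auto simp: cond_iid_def)
  have OI[measurable]: "(\<lambda>\<omega>. order_interval m l u (\<lambda>i. X i \<omega>)) \<in> borel_measurable M"
    by (rule measurable_order_interval[OF l X_meas])
  have "distr M lborel (\<lambda>\<omega>. order_interval m l u (\<lambda>i. X i \<omega>)) =
    density lborel (\<lambda>z. ennreal (\<integral>\<theta>. k \<theta> z \<partial>lborel))"
  proof (rule measure_eqI)
    fix C :: "(real \<times> real) set"
    assume "C \<in> sets (distr M lborel (\<lambda>\<omega>. order_interval m l u (\<lambda>i. X i \<omega>)))"
    then have C[measurable]: "C \<in> sets borel" by simp
    let ?B = "PiM {1..m} (\<lambda>_. borel :: real measure)"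
    define B where "B = {x \<in> space ?B. order_interval m l u x \<in> C}"
    have B: "B \<in> sets ?B"
    proof -
      have "(\<lambda>x. order_interval m l u (\<lambda>i. x i)) \<in> borel_measurable ?B"
        by (rule measurable_order_interval[OF l]) measurable
      then show ?thesis unfolding B_def by measurable
    qed
    \<comment> \<open>The location-scale formula is used for all \<theta>, which makes
      \<open>g\<close> jointly measurable.\<close>
    define g where "g \<theta> x = f0 ((x - fst \<theta>) / snd \<theta>) / snd \<theta>" for \<theta> x
    have g: "case_prod g \<in> borel_measurable (borel \<Otimes>\<^sub>M borel)"
    proof -
      note [measurable] = prob_densityD(1)[OF f0]
      have "case_prod g \<in> borel_measurable ((borel \<Otimes>\<^sub>M borel) \<Otimes>\<^sub>M borel)"
        unfolding g_def by measurable
      then show ?thesis unfolding borel_prod .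
    qed
    have "emeasure (distr M lborel (\<lambda>\<omega>. order_interval m l u (\<lambda>i. X i \<omega>))) C =
      emeasure M {\<omega> \<in> space M. order_interval m l u (\<lambda>i. X i \<omega>) \<in> C}"
      by (subst emeasure_distr) (auto intro!: arg_cong[where f="emeasure M"])
    also have "{\<omega> \<in> space M. order_interval m l u (\<lambda>i. X i \<omega>) \<in> C} =
        {\<omega> \<in> space M. (\<lambda>i\<in>{1..m}. X i \<omega>) \<in> B}"
    proof -
      have "order_interval m l u (\<lambda>i. X i \<omega>) = order_interval m l u (\<lambda>i\<in>{1..m}. X i \<omega>)" for \<omega>
        by (rule order_interval_cong) simp
      moreover have "(\<lambda>i\<in>{1..m}. X i \<omega>) \<in> space ?B" for \<omega>
        by (simp add: space_PiM)
      ultimately show ?thesis by (simp add: B_def)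
    qed
    also have "emeasure M \<dots> = (\<integral>\<^sup>+\<theta>. ?w \<theta> * (\<integral>\<^sup>+x. (\<Prod>k\<in>{1..m}. ennreal (g \<theta> (x k))) * indicator B x
      \<partial>PiM {1..m} (\<lambda>_. lborel :: real measure)) \<partial>lborel)"
      by (rule emeasure_cond_iid[OF M \<Theta> X g _ B])
        (auto simp: g_def fun_eq_iff f_eq' indicator_def split: if_splits)
    also have "\<dots> = (\<integral>\<^sup>+\<theta>. (\<integral>\<^sup>+z. ennreal (k \<theta> z) * indicator C z \<partial>lborel) \<partial>lborel)"
    proof (rule nn_integral_cong)
      fix \<theta>
      show "?w \<theta> * (\<integral>\<^sup>+x. (\<Prod>k\<in>{1..m}. ennreal (g \<theta> (x k))) * indicator B x
          \<partial>PiM {1..m} (\<lambda>_. lborel :: real measure)) = (\<integral>\<^sup>+z. ennreal (k \<theta> z) * indicator C z \<partial>lborel)"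
      proof (cases "\<theta> \<in> param_space")
        case True
        note pd = prob_density_f[OF True]
        have meas: "(\<lambda>z. ennreal (iid_interval_density (f \<theta>) m l u (fst z) (snd z)) * indicator C z) \<in> borel_measurable (borel \<Otimes>\<^sub>M borel)"
          using borel_measurable_iid_interval_density[OF pd, of m l u] C[folded borel_prod]
          by (simp add: split_beta')
        have "(\<integral>\<^sup>+x. (\<Prod>k\<in>{1..m}. ennreal (g \<theta> (x k))) * indicator B x \<partial>PiM {1..m} (\<lambda>_. lborel :: real measure)) =
          (\<integral>\<^sup>+x. (\<Prod>k\<in>{1..m}. ennreal (f \<theta> (x k))) * indicator C (order_interval m l u x) \<partial>PiM {1..m} (\<lambda>_. lborel :: real measure))"
          by (intro nn_integral_cong) (auto simp: B_def space_PiM indicator_def g_def f_eq'[OF True])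
        also have "\<dots> = (\<integral>\<^sup>+a. \<integral>\<^sup>+b. ennreal (iid_interval_density (f \<theta>) m l u a b) * indicator C (a, b) \<partial>lborel \<partial>lborel)"
          by (rule nn_integral_order_interval[OF pd l C])
        also have "\<dots> = (\<integral>\<^sup>+z. ennreal (iid_interval_density (f \<theta>) m l u (fst z) (snd z)) * indicator C z \<partial>(lborel \<Otimes>\<^sub>M lborel))"
          using meas by (subst lborel.nn_integral_fst[symmetric]) (auto cong: measurable_cong_sets)
        also have "ennreal (\<pi> \<theta>) * \<dots> = (\<integral>\<^sup>+z. ennreal (\<pi> \<theta>) * (ennreal (iid_interval_density (f \<theta>) m l u (fst z) (snd z)) * indicator C z) \<partial>(lborel \<Otimes>\<^sub>M lborel))"
          using meas by (subst nn_integral_cmult) (auto cong: measurable_cong_sets)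
        also have "\<dots> = (\<integral>\<^sup>+z. ennreal (k \<theta> z) * indicator C z \<partial>lborel)"
          unfolding lborel_prod k_def using True \<pi>0[OF True] iid_interval_density_nonneg[OF pd]
          by (intro nn_integral_cong) (auto simp: ennreal_mult mult_ac)
        finally show ?thesis using True by simp
      qed (simp add: k_def)
    qed
    also have "\<dots> = (\<integral>\<^sup>+z. (\<integral>\<^sup>+\<theta>. ennreal (k \<theta> z) * indicator C z \<partial>lborel) \<partial>lborel)"
      by (rule lborel_pair.Fubini'[symmetric]) measurable
    also have "\<dots> = (\<integral>\<^sup>+z. ennreal (\<integral>\<theta>. k \<theta> z \<partial>lborel) * indicator C z \<partial>lborel)"
    proof (rule nn_integral_cong_AE)
      have "AE z in lborel. \<forall>t. (z :: real \<times> real) \<noteq> (t, t)"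
      proof -
        have "AE z in lborel \<Otimes>\<^sub>M lborel. fst z \<noteq> (snd z :: real)"
        proof (rule lborel_pair.AE_pair_measure)
          have "Measurable.pred (lborel \<Otimes>\<^sub>M lborel) (\<lambda>x. fst x \<noteq> (snd x :: real))" by measurable
          then show "{x \<in> space (lborel \<Otimes>\<^sub>M lborel). fst x \<noteq> (snd x :: real)} \<in> sets (lborel \<Otimes>\<^sub>M lborel)"
            by (simp add: pred_def)
          show "AE x in lborel. AE y in lborel. fst (x, y) \<noteq> (snd (x, y) :: real)"
            by (intro AE_I2 eventually_mono[OF AE_lborel_singleton]) auto
        qed
        then show ?thesis unfolding lborel_prod by eventually_elim auto
      qed
      then show "AE z in lborel. (\<integral>\<^sup>+\<theta>. ennreal (k \<theta> z) * indicator C z \<partial>lborel) =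
        ennreal (\<integral>\<theta>. k \<theta> z \<partial>lborel) * indicator C z"
      proof eventually_elim
        fix z :: "real \<times> real" assume z: "\<forall>t. z \<noteq> (t, t)"
        have [measurable]: "(\<lambda>\<theta>. k \<theta> z) \<in> borel_measurable borel"
          using measurable_compose[OF measurable_Pair2' k_meas, of z] by simp
        have "(\<integral>\<^sup>+\<theta>. ennreal (k \<theta> z) \<partial>lborel) = ennreal (\<integral>\<theta>. k \<theta> z \<partial>lborel)"
        proof (cases "fst z < snd z")
          case True
          have "(\<integral>\<^sup>+\<theta>. ennreal (k \<theta> z) \<partial>lborel) =
            (\<integral>\<^sup>+\<theta>\<in>param_space. ennreal (\<bar>iid_interval_density (f \<theta>) m l u (fst z) (snd z)\<bar> * \<pi> \<theta>) \<partial>lborel)"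
            using iid_interval_density_nonneg[OF prob_density_f]
            by (intro nn_integral_cong) (auto simp: k_def indicator_def)
          also have "\<dots> < \<infinity>" by (rule fin[OF True])
          finally have "integrable lborel (\<lambda>\<theta>. k \<theta> z)"
            using k_nonneg by (intro integrableI_nonneg) auto
          then show ?thesis using k_nonneg by (intro nn_integral_eq_integral) auto
        next
          case False
          then have "\<not> fst z \<le> snd z" using z by (cases z) auto
          then have "k \<theta> z = 0" for \<theta> by (simp add: k_def iid_interval_density_def)
          then show ?thesis by simp
        qed
        then show "(\<integral>\<^sup>+\<theta>. ennreal (k \<theta> z) * indicator C z \<partial>lborel) = ennreal (\<integral>\<theta>. k \<theta> z \<partial>lborel) * indicator C z"
          by (cases "z \<in> C") auto
      qed
    qed
    also have "\<dots> = emeasure (density lborel (\<lambda>z. ennreal (\<integral>\<theta>. k \<theta> z \<partial>lborel))) C"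
      by (subst emeasure_density) auto
    finally show "emeasure (distr M lborel (\<lambda>\<omega>. order_interval m l u (\<lambda>i. X i \<omega>))) C =
      emeasure (density lborel (\<lambda>z. ennreal (\<integral>\<theta>. k \<theta> z \<partial>lborel))) C" .
  qed simp
  then show ?thesis
    using OI dens_meas by (simp add: distributed_def dens split_beta')
qed

end

section \<open>Concentration of order statistics\<close>

text \<open>The left side is one nonnegative term in the expansion of (x + (1 - x)) ^ (a + b) =
  1.\<close>

lemma binomial_term_le_1:
  fixes x :: real
  assumes "0 \<le> x" "x \<le> 1"
  shows "real (a + b choose a) * x ^ a * (1 - x) ^ b \<le> 1"
proof -
  have "real (a + b choose a) * x ^ a * (1 - x) ^ (a + b - a) \<le>
      (\<Sum>k\<le>a + b. real (a + b choose k) * x ^ k * (1 - x) ^ (a + b - k))"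
    using assms by (intro member_le_sum[of a]) auto
  also have "\<dots> = (x + (1 - x)) ^ (a + b)"
    by (rule binomial_ring[symmetric])
  finally show ?thesis by simp
qed

text \<open>The inequality 1 + s \<le> exp s is taken at s = sqrt x - 1 and raised to the power 2 k;
  the square root is what later turns the exponent into a sum of squares.\<close>

lemma power_le_exp_sqrt:
  fixes x :: real
  assumes "0 \<le> x"
  shows "x ^ k \<le> exp (2 * real k * (sqrt x - 1))"
proof -
  have "sqrt x \<le> exp (sqrt x - 1)" using exp_ge_add_one_self[of "sqrt x - 1"] by simp
  then have "sqrt x ^ (2 * k) \<le> exp (sqrt x - 1) ^ (2 * k)" using assms by (intro power_mono) auto
  also have "exp (sqrt x - 1) ^ (2 * k) = exp (real (2 * k) * (sqrt x - 1))"
    by (rule exp_of_nat_mult[symmetric])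
  finally show ?thesis using assms by (simp add: power_mult)
qed

text \<open>Comparing with the term at the frequencies \<open>q = (a, b, c) / n\<close>, which is at most 1, leaves
  \<open>\<Prod>i. (x i / q i) ^ (n * q i)\<close>. Since \<open>t \<le> exp (2 * (sqrt t - 1))\<close>, this is at most
  \<open>exp (- n * (\<Sum>i. (sqrt (x i) - sqrt (q i))\<^sup>2))\<close>, without case distinction for \<open>x i = 0\<close>.\<close>

lemma multinomial_term_le:
  fixes x y z :: real
  assumes pos: "0 < a" "0 < b" "0 < c" and n: "n = a + b + c"
    and xyz: "0 \<le> x" "0 \<le> y" "0 \<le> z" "x + y + z = 1"
  shows "fact n / (fact a * fact b * fact c) * x ^ a * y ^ b * z ^ c \<le>
    exp (- (real n / 4) * ((x - real a / real n)\<^sup>2 + (z - real c / real n)\<^sup>2))"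
proof -
  define qa qb qc where q: "qa = real a / real n" "qb = real b / real n" "qc = real c / real n"
  have n0: "0 < real n" using pos n by simp
  have q0: "0 < qa" "0 < qb" "0 < qc" using pos n0 by (auto simp: q)
  have q1: "qa + qb + qc = 1" 
  proof -
    have "qa + qb + qc = (real a + real b + real c) / real n"
      by (simp add: q add_divide_distrib)
    then show ?thesis using n n0 by simp
  qed
  let ?C = "fact n / (fact a * fact b * fact c) :: real"
  have C1: "?C * (qa ^ a * qb ^ b * qc ^ c) \<le> 1"
  proof -
    \<comment> \<open>A trinomial term is a product of two binomial ones: \<open>a\<close> against
      \<open>b + c\<close> with probability \<open>qa\<close>, then \<open>b\<close> against
      \<open>c\<close> with the conditional probability \<open>s\<close>.\<close>
    define s where "s = real b / real (b + c)"
    have s: "0 \<le> s" "s \<le> 1" using pos by (auto simp: s_def)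
    have "1 - qa = qb + qc" using q1 by simp
    also have "\<dots> = real (b + c) / real n" by (simp add: q add_divide_distrib)
    finally have qbc: "1 - qa = real (b + c) / real n" .
    have "1 - s = (real (b + c) - real b) / real (b + c)"
      unfolding diff_divide_distrib s_def using pos by simp
    then have s': "1 - s = real c / real (b + c)" by simp
    have "(1 - qa) * s = qb" "(1 - qa) * (1 - s) = qc"
      unfolding qbc s' using pos by (simp_all add: q s_def)
    then have e: "qb ^ b = (1 - qa) ^ b * s ^ b" "qc ^ c = (1 - qa) ^ c * (1 - s) ^ c"
      by (simp_all flip: power_mult_distrib)
    have "real (a + (b + c) choose a) = fact n / (fact a * fact (b + c))"
      using n by (subst binomial_fact) (auto simp: add.assoc)
    moreover have "real (b + c choose b) = fact (b + c) / (fact b * fact c)"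
      by (subst binomial_fact) auto
    ultimately have "?C = real (a + (b + c) choose a) * real (b + c choose b)" by simp
    then have "?C * (qa ^ a * qb ^ b * qc ^ c) = (real (a + (b + c) choose a) * qa ^ a * (1 - qa) ^ (b + c)) *
        (real (b + c choose b) * s ^ b * (1 - s) ^ c)"
      by (simp add: e power_add mult_ac)
    also have "\<dots> \<le> 1 * 1"
      using q0 q1 s by (intro mult_mono binomial_term_le_1) auto
    finally show ?thesis by simp
  qed
  \<comment> \<open>The sum of the two square roots is at most 2, whence the factor 1/4 in the final
    exponent.\<close>
  have dist: "(t - r)\<^sup>2 / 4 \<le> (sqrt t - sqrt r)\<^sup>2" if "0 \<le> t" "t \<le> 1" "0 \<le> r" "r \<le> 1" for t r :: real
  proof -
    have "t - r = (sqrt t - sqrt r) * (sqrt t + sqrt r)"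
      using that by (simp add: algebra_simps flip: power2_eq_square)
    then have "(t - r)\<^sup>2 = (sqrt t - sqrt r)\<^sup>2 * (sqrt t + sqrt r)\<^sup>2" by (simp add: power_mult_distrib)
    also have "\<dots> \<le> (sqrt t - sqrt r)\<^sup>2 * 2\<^sup>2"
    proof -
      have "sqrt t \<le> 1" "sqrt r \<le> 1" using that by auto
      then have "sqrt t + sqrt r \<le> 2" by linarith
      then show ?thesis using that by (intro mult_left_mono power_mono) auto
    qed
    finally show ?thesis by simp
  qed
  \<comment> \<open>The part linear in \<open>r - t\<close> cancels on summation, because the
    probabilities and the frequencies both sum to 1.\<close>
  have sq: "2 * real n * (t * (sqrt (r / t) - 1)) = - real n * (sqrt r - sqrt t)\<^sup>2 + real n * (r - t)"
    if "0 < t" "0 \<le> r" for t r :: real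
  proof -
    have "t * sqrt (r / t) = sqrt t * sqrt r"
      using that by (simp add: real_sqrt_divide) (metis less_eq_real_def mult.commute real_div_sqrt times_divide_eq_right)
    then show ?thesis using that by (simp add: power2_eq_square algebra_simps)
  qed
  have "?C * x ^ a * y ^ b * z ^ c = ?C * (qa ^ a * qb ^ b * qc ^ c) * ((x / qa) ^ a * (y / qb) ^ b * (z / qc) ^ c)"
    using q0 by (simp add: power_divide)
  also have "\<dots> \<le> 1 * ((x / qa) ^ a * (y / qb) ^ b * (z / qc) ^ c)"
    using C1 q0 xyz by (intro mult_right_mono) auto
  also have "\<dots> \<le> 1 * (exp (2 * real a * (sqrt (x / qa) - 1)) * exp (2 * real b * (sqrt (y / qb) - 1)) *
      exp (2 * real c * (sqrt (z / qc) - 1)))"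
    using q0 xyz by (intro mult_left_mono mult_mono power_le_exp_sqrt) auto
  also have "\<dots> = exp (2 * real n * (qa * (sqrt (x / qa) - 1)) + 2 * real n * (qb * (sqrt (y / qb) - 1)) +
      2 * real n * (qc * (sqrt (z / qc) - 1)))"
    using n0 by (simp add: q exp_add mult.assoc)
  also have "\<dots> = exp (- real n * ((sqrt x - sqrt qa)\<^sup>2 + (sqrt y - sqrt qb)\<^sup>2 + (sqrt z - sqrt qc)\<^sup>2) +
      real n * ((x + y + z) - (qa + qb + qc)))"
    unfolding sq[OF q0(1) xyz(1)] sq[OF q0(2) xyz(2)] sq[OF q0(3) xyz(3)]
    by (simp add: algebra_simps)
  also have "\<dots> \<le> exp (- (real n / 4) * ((x - qa)\<^sup>2 + (z - qc)\<^sup>2))"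
  proof -
    have "(x - qa)\<^sup>2 / 4 \<le> (sqrt x - sqrt qa)\<^sup>2" "(z - qc)\<^sup>2 / 4 \<le> (sqrt z - sqrt qc)\<^sup>2"
      using q0 q1 xyz by (auto intro!: dist simp del: divide_le_eq_numeral1)
    then have "((x - qa)\<^sup>2 + (z - qc)\<^sup>2) / 4 \<le> (sqrt x - sqrt qa)\<^sup>2 + (sqrt y - sqrt qb)\<^sup>2 + (sqrt z - sqrt qc)\<^sup>2"
      using zero_le_power2[of "sqrt y - sqrt qb"] by argo
    from mult_left_mono[OF this, of "real n"] show ?thesis
      using n0 by (simp add: q1 xyz(4))
  qed
  finally show ?thesis by (simp add: q)
qed

text \<open>The quotient of the order statistic densities for \<open>(m, l, u)\<close> and \<open>(3, 1, 2)\<close>. The constant \<open>6\<close> is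
  \<open>3!\<close>, and the missing factor \<open>1 - z\<close> is in the latter density.\<close>

definition order_weight :: "nat \<Rightarrow> nat \<Rightarrow> nat \<Rightarrow> real \<Rightarrow> real \<Rightarrow> real" where
  "order_weight m l u y z = fact m / (fact (l - 1) * fact (u - l - 1) * fact (m - u)) / 6 *
     y ^ (l - 1) * (z - y) ^ (u - l - 1) * (1 - z) ^ (m - u - 1)"

lemma iid_interval_density_eq_order_weight:
  assumes "0 < l" "l < u" "u < m"
  shows "iid_interval_density g m l u x x' =
    order_weight m l u (density_cdf g x) (density_cdf g x') * iid_interval_density g 3 1 2 x x'"
proof -
  have "(1 - density_cdf g x') ^ (m - u) = (1 - density_cdf g x') ^ (m - u - 1) * (1 - density_cdf g x')"
    using assms by (metis Suc_diff_Suc Suc_pred' diff_Suc_1 power_Suc2 zero_less_diff)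
  moreover have "fact 3 = (6 :: real)" by (simp add: eval_nat_numeral)
  ultimately show ?thesis
    by (simp add: iid_interval_density_def order_weight_def mult_ac
        del: right_diff_distrib_numeral left_diff_distrib_numeral)
qed

lemma order_weight_nonneg: "0 \<le> y \<Longrightarrow> y \<le> z \<Longrightarrow> z \<le> 1 \<Longrightarrow> 0 \<le> order_weight m l u y z"
  by (simp add: order_weight_def)

text \<open>The exponents l - 1, u - l - 1 and m - u - 1 add up to m - 3. Splitting m (m - 1) (m -
  2) and 1 / (m - u) off the factorials leaves a trinomial term of size m - 3; the hypotheses make
  all three exponents positive, as \<open>multinomial_term_le\<close> demands.\<close>

lemma order_weight_bound:
  assumes l: "2 \<le> l" "l + 2 \<le> u" "u + 2 \<le> m" and yz: "0 \<le> y" "y \<le> z" "z \<le> 1"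
  shows "order_weight m l u y z \<le> real m ^ 3 * exp (- (real (m - 3) / 4) *
    ((y - real (l - 1) / real (m - 3))\<^sup>2 + ((1 - z) - real (m - u - 1) / real (m - 3))\<^sup>2))"
proof -
  let ?t = "fact (m - 3) / (fact (l - 1) * fact (u - l - 1) * fact (m - u - 1)) *
     y ^ (l - 1) * (z - y) ^ (u - l - 1) * (1 - z) ^ (m - u - 1)"
  have f1: "(fact m :: real) = real m * real (m - 1) * real (m - 2) * fact (m - 3)"
    using l fact_reduce[of m, where 'a=real] fact_reduce[of "m - 1", where 'a=real]
      fact_reduce[of "m - 2", where 'a=real] by (simp add: numeral_2_eq_2 numeral_3_eq_3)
  have f2: "(fact (m - u) :: real) = real (m - u) * fact (m - u - 1)"
    using l fact_reduce[of "m - u", where 'a=real] by simp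
  have "order_weight m l u y z = real m * real (m - 1) * real (m - 2) / (6 * real (m - u)) * ?t"
    unfolding order_weight_def f1 f2 by (simp add: mult_ac)
  also have "\<dots> \<le> real m ^ 3 * ?t"
  proof (rule mult_right_mono)
    have "real m * real (m - 1) * real (m - 2) \<le> real m * real m * real m"
      by (intro mult_mono) auto
    also have "\<dots> \<le> real m ^ 3 * (6 * real (m - u))"
      using l by (simp add: power3_eq_cube)
    finally show "real m * real (m - 1) * real (m - 2) / (6 * real (m - u)) \<le> real m ^ 3"
      using l by (simp add: divide_le_eq)
  qed (use yz in auto)
  also have "\<dots> \<le> real m ^ 3 * exp (- (real (m - 3) / 4) *
    ((y - real (l - 1) / real (m - 3))\<^sup>2 + ((1 - z) - real (m - u - 1) / real (m - 3))\<^sup>2))"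
    using l yz by (intro mult_left_mono multinomial_term_le) auto
  finally show ?thesis .
qed

text \<open>The frequencies (l - 1) / (m - 3) and (m - u - 1) / (m - 3) tend to p and 1 - p'. So if
  y or z is at least \<delta> away from its limit, then y or 1 - z is eventually at least \<delta> /
  2 away from its frequency, uniformly in (y, z), and exponential decay beats the factor m ^
  3.\<close>

lemma order_weight_uniform:
  fixes l u :: "nat \<Rightarrow> nat"
  assumes lp: "(\<lambda>m. real (l m) / (real m + 1)) \<longlonglongrightarrow> p"
    and up: "(\<lambda>m. real (u m) / (real m + 1)) \<longlonglongrightarrow> p'"
    and p: "0 < p" "p < p'" "p' < 1" and \<delta>: "0 < \<delta>" and \<eta>: "0 < \<eta>"
  shows "\<forall>\<^sub>F m in sequentially. 0 < l m \<and> l m < u m \<and> u m < m \<and>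
    (\<forall>y z. 0 \<le> y \<longrightarrow> y \<le> z \<longrightarrow> z \<le> 1 \<longrightarrow> \<delta> \<le> \<bar>y - p\<bar> \<or> \<delta> \<le> \<bar>z - p'\<bar> \<longrightarrow>
      order_weight m (l m) (u m) y z \<le> \<eta>)"
proof -
  have inv: "(\<lambda>m. 1 / (real m + 1)) \<longlonglongrightarrow> 0"
    using LIMSEQ_inverse_real_of_nat by (simp add: inverse_eq_divide add.commute)
  have den: "(\<lambda>m. (real m - 3) / (real m + 1)) \<longlonglongrightarrow> 1"
  proof -
    have "(\<lambda>m. 1 - 4 * (1 / (real m + 1))) \<longlonglongrightarrow> 1 - 4 * 0" by (intro tendsto_intros inv)
    moreover have "1 - 4 * (1 / (real m + 1)) = (real m - 3) / (real m + 1)" for m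
      by (simp add: field_simps)
    ultimately show ?thesis by simp
  qed
  \<comment> \<open>Dividing numerator and denominator by m + 1 expresses the frequencies through
    the given limits.\<close>
  have eq: "(t / (real m + 1)) / ((real m - 3) / (real m + 1)) = t / (real m - 3)" for t m by simp
  have "(\<lambda>m. (real (l m) / (real m + 1) - 1 / (real m + 1)) / ((real m - 3) / (real m + 1))) \<longlonglongrightarrow> (p - 0) / 1"
    by (intro tendsto_intros lp inv den) simp
  then have l_lim: "(\<lambda>m. (real (l m) - 1) / (real m - 3)) \<longlonglongrightarrow> p"
    by (simp only: diff_divide_distrib[symmetric] eq diff_zero div_by_1)
  have "(\<lambda>m. (1 - 2 * (1 / (real m + 1)) - real (u m) / (real m + 1)) / ((real m - 3) / (real m + 1))) \<longlonglongrightarrow> (1 - 2 * 0 - p') / 1"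
    by (intro tendsto_intros up inv den) simp
  moreover have "1 - 2 * (1 / (real m + 1)) - real (u m) / (real m + 1) = (real m - real (u m) - 1) / (real m + 1)" for m
  proof -
    have "(real m - real (u m) - 1) / (real m + 1) = ((real m + 1) - 2 - real (u m)) / (real m + 1)"
      by (rule arg_cong2[where f="(/)"]) auto
    also have "\<dots> = 1 - 2 * (1 / (real m + 1)) - real (u m) / (real m + 1)"
      unfolding diff_divide_distrib by simp
    finally show ?thesis ..
  qed
  ultimately have u_lim: "(\<lambda>m. (real m - real (u m) - 1) / (real m - 3)) \<longlonglongrightarrow> 1 - p'"
    by (simp only: eq) simp
  \<comment> \<open>One half of \<delta> is spent on the distance of the frequencies from their
    limits; the other half gives the square of \<delta> / 2, times the 1/4 of
    \<open>multinomial_term_le\<close>.\<close>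
  define c where "c = \<delta>\<^sup>2 / 16"
  have c: "0 < c" using \<delta> by (simp add: c_def)
  have exp_lim: "(\<lambda>m. real m ^ 3 * exp (- (real m - 3) * c)) \<longlonglongrightarrow> 0"
  proof -
    have "filterlim (\<lambda>m. c * real m) at_top sequentially"
      using c by (intro filterlim_tendsto_pos_mult_at_top[OF tendsto_const _ filterlim_real_sequentially])
    then have "(\<lambda>m. exp (3 * c) / c ^ 3 * ((c * real m) ^ 3 / exp (c * real m))) \<longlonglongrightarrow> exp (3 * c) / c ^ 3 * 0"
      by (intro tendsto_intros filterlim_compose[OF tendsto_power_div_exp_0])
    moreover have "exp (- (real m - 3) * c) = exp (3 * c) / exp (c * real m)" for m
      by (simp add: exp_diff[symmetric] algebra_simps)
    then have "exp (3 * c) / c ^ 3 * ((c * real m) ^ 3 / exp (c * real m)) = real m ^ 3 * exp (- (real m - 3) * c)" for m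
      using c by (simp only: power_mult_distrib) simp
    ultimately show ?thesis by simp
  qed
  \<comment> \<open>\<open>\<epsilon>\<close> lies below the three limiting gaps p, p' - p and 1 -
    p'. Once 1 / (m + 1) < \<epsilon> / 3, a gap above \<epsilon> (m + 1) spans more than 3 ranks,
    which covers the rank conditions of \<open>order_weight_bound\<close>.\<close>
  obtain \<epsilon> where \<epsilon>: "0 < \<epsilon>" "\<epsilon> < p" "\<epsilon> < p' - p" "\<epsilon> < 1 - p'"
    using p that[of "min p (min (p' - p) (1 - p')) / 2"] by (auto simp: min_def)
  have "\<forall>\<^sub>F m in sequentially. \<epsilon> < real (l m) / (real m + 1)"
    using lp \<epsilon> by (auto dest: order_tendstoD(1))
  moreover have "\<forall>\<^sub>F m in sequentially. \<epsilon> < real (u m) / (real m + 1) - real (l m) / (real m + 1)"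
    using tendsto_diff[OF up lp] \<epsilon> by (auto dest: order_tendstoD(1))
  moreover have "\<forall>\<^sub>F m in sequentially. \<epsilon> < 1 - real (u m) / (real m + 1)"
    using tendsto_diff[OF tendsto_const up, of 1] \<epsilon> by (auto dest: order_tendstoD(1))
  moreover have "\<forall>\<^sub>F m in sequentially. 1 / (real m + 1) < \<epsilon> / 3"
    by (rule order_tendstoD(2)[OF inv]) (use \<epsilon> in simp)
  moreover have "\<forall>\<^sub>F m in sequentially. dist ((real (l m) - 1) / (real m - 3)) p < \<delta> / 2"
    using l_lim \<delta> by (intro tendstoD) auto
  moreover have "\<forall>\<^sub>F m in sequentially. dist ((real m - real (u m) - 1) / (real m - 3)) (1 - p') < \<delta> / 2"
    using u_lim \<delta> by (intro tendstoD) auto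
  moreover have "\<forall>\<^sub>F m in sequentially. real m ^ 3 * exp (- (real m - 3) * c) < \<eta>"
    using exp_lim \<eta> by (auto dest: order_tendstoD(2))
  ultimately show ?thesis
  proof eventually_elim
    case (elim m)
    have e3: "3 < \<epsilon> * (real m + 1)" using elim(4) by (simp add: field_simps)
    have "\<epsilon> * (real m + 1) < real (l m)" using elim(1) by (simp add: field_simps)
    then have "3 < real (l m)" using e3 by linarith
    then have l: "3 < l m" by linarith
    have "\<epsilon> < (real (u m) - real (l m)) / (real m + 1)" using elim(2) by (simp add: diff_divide_distrib)
    then have "\<epsilon> * (real m + 1) < real (u m) - real (l m)" by (simp add: field_simps)
    then have "3 < real (u m) - real (l m)" using e3 by linarith
    then have u: "l m + 3 < u m" by linarith
    have "\<epsilon> * (real m + 1) < real m + 1 - real (u m)" using elim(3) by (simp add: field_simps)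
    then have "3 < real m + 1 - real (u m)" using e3 by linarith
    then have m: "u m + 2 < m" by linarith
    have "order_weight m (l m) (u m) y z \<le> \<eta>"
      if yz: "0 \<le> y" "y \<le> z" "z \<le> 1" and far: "\<delta> \<le> \<bar>y - p\<bar> \<or> \<delta> \<le> \<bar>z - p'\<bar>" for y z
    proof -
      define A where "A = y - real (l m - 1) / real (m - 3)"
      define B where "B = (1 - z) - real (m - u m - 1) / real (m - 3)"
      have "real (l m - 1) / real (m - 3) = (real (l m) - 1) / (real m - 3)"
        using l u m by (simp add: of_nat_diff)
      then have A: "\<bar>y - p\<bar> \<le> \<bar>A\<bar> + \<delta> / 2"
        using elim(5) dist_triangle[of y p "real (l m - 1) / real (m - 3)"]
        unfolding A_def by (simp only: dist_real_def)
      have "real (m - u m - 1) / real (m - 3) = (real m - real (u m) - 1) / (real m - 3)"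
        using l u m by (simp add: of_nat_diff)
      then have B: "\<bar>z - p'\<bar> \<le> \<bar>B\<bar> + \<delta> / 2"
        using elim(6) dist_triangle[of "1 - z" "1 - p'" "real (m - u m - 1) / real (m - 3)"] abs_minus_commute[of z p']
        unfolding B_def by (simp only: dist_real_def) argo
      have "(\<delta> / 2)\<^sup>2 \<le> A\<^sup>2 + B\<^sup>2"
      proof (cases "\<delta> / 2 \<le> \<bar>A\<bar>")
        case True
        then have "(\<delta> / 2)\<^sup>2 \<le> \<bar>A\<bar>\<^sup>2" using \<delta> by (intro power_mono) auto
        then show ?thesis using zero_le_power2[of B] by (simp only: power2_abs)
      next
        case False
        then have "\<delta> / 2 \<le> \<bar>B\<bar>" using A B far by linarith
        then have "(\<delta> / 2)\<^sup>2 \<le> \<bar>B\<bar>\<^sup>2" using \<delta> by (intro power_mono) auto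
        then show ?thesis using zero_le_power2[of A] by (simp only: power2_abs)
      qed
      then have "c \<le> (A\<^sup>2 + B\<^sup>2) / 4" by (simp add: c_def power_divide)
      then have "(real m - 3) * c \<le> (real m - 3) * ((A\<^sup>2 + B\<^sup>2) / 4)"
        using l u m by (intro mult_left_mono) auto
      moreover have m3: "real (m - 3) = real m - 3" using l u m by (simp add: of_nat_diff)
      have "- (real (m - 3) / 4) * (A\<^sup>2 + B\<^sup>2) = - ((real m - 3) * ((A\<^sup>2 + B\<^sup>2) / 4))"
        unfolding m3 by simp
      ultimately have "- (real (m - 3) / 4) * (A\<^sup>2 + B\<^sup>2) \<le> - (real m - 3) * c"
        unfolding mult_minus_left[of "real m - 3" c] by linarith
      then have "real m ^ 3 * exp (- (real (m - 3) / 4) * (A\<^sup>2 + B\<^sup>2)) \<le> real m ^ 3 * exp (- (real m - 3) * c)"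
        by (intro mult_left_mono) auto
      moreover have "order_weight m (l m) (u m) y z \<le> real m ^ 3 * exp (- (real (m - 3) / 4) * (A\<^sup>2 + B\<^sup>2))"
        unfolding A_def B_def using l u m yz by (intro order_weight_bound) auto
      ultimately show ?thesis using elim(7) by linarith
    qed
    then show ?case using l u m by auto
  qed
qed

section \<open>Change of variables between parameters and standardised endpoints\<close>

lemma nn_integral_inverse_substitution:
  fixes \<phi> :: "real \<Rightarrow> ennreal"
  assumes [measurable]: "\<phi> \<in> borel_measurable borel" and d: "0 < d"
  shows "(\<integral>\<^sup>+t. indicator {0<..} t * (ennreal (d / t\<^sup>2) * \<phi> (d / t)) \<partial>lborel) =
    (\<integral>\<^sup>+s. indicator {0<..} s * \<phi> s \<partial>lborel)"
proof -
  \<comment> \<open>The map from t to d / t carries \<open>J n\<close> onto \<open>K n\<close>, and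
    both increase to the positive half-line. The summand 2 keeps the interval nondegenerate at n =
    0.\<close>
  define J where "J n = {1 / (real n + 2) .. real n + 2}" for n
  define K where "K n = {d / (real n + 2) .. d * (real n + 2)}" for n
  have [measurable]: "J n \<in> sets borel" "K n \<in> sets borel" for n by (auto simp: J_def K_def)
  have "incseq J"
    unfolding J_def by (intro monoI) (auto simp: le_fun_def frac_le elim!: order_trans[rotated])
  have "incseq K"
    unfolding K_def using d
    by (intro monoI) (auto intro!: divide_left_mono mult_left_mono elim!: order_trans[rotated] order_trans)
  have large: "\<exists>n. t \<in> J n" if "0 < t" for t
  proof -
    obtain n where n: "max t (1 / t) \<le> real n" using real_arch_simple by blast
    then have "1 / t \<le> real n + 2" "t \<le> real n + 2" by auto
    then have "1 / (real n + 2) \<le> t" using that by (simp add: field_simps)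
    with \<open>t \<le> real n + 2\<close> show ?thesis by (auto simp: J_def intro!: exI[of _ n])
  qed
  have UJ: "(\<Union>n. J n) = {0<..}"
  proof (intro equalityI subsetI)
    fix t assume "t \<in> (\<Union>n. J n)"
    then obtain n where "1 / (real n + 2) \<le> t" by (auto simp: J_def)
    moreover have "0 < 1 / (real n + 2)" by simp
    ultimately show "t \<in> {0<..}" by (simp only: greaterThan_iff)
  qed (use large in auto)
  have UK: "(\<Union>n. K n) = {0<..}"
  proof (intro equalityI subsetI)
    fix t assume "t \<in> (\<Union>n. K n)"
    then obtain n where "d / (real n + 2) \<le> t" by (auto simp: K_def)
    moreover have "0 < d / (real n + 2)" using d by simp
    ultimately show "t \<in> {0<..}" by (simp only: greaterThan_iff)
  next
    fix t :: real assume t: "t \<in> {0<..}"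
    then obtain n where "t / d \<in> J n" using large[of "t / d"] d by auto
    then show "t \<in> (\<Union>n. K n)" using d by (auto simp: J_def K_def field_simps)
  qed
  have lim: "(\<integral>\<^sup>+t. indicator (\<Union>n. I n) t * h t \<partial>lborel) = (SUP n. \<integral>\<^sup>+t. indicator (I n) t * h t \<partial>lborel)"
    if "incseq I" and [measurable]: "\<And>n. I n \<in> sets borel" "h \<in> borel_measurable borel"
    for I :: "nat \<Rightarrow> real set" and h :: "real \<Rightarrow> ennreal"
  proof -
    have "(\<integral>\<^sup>+t. indicator (\<Union>n. I n) t * h t \<partial>lborel) = (\<integral>\<^sup>+t. (SUP n. indicator (I n) t * h t) \<partial>lborel)"
    proof (rule nn_integral_cong)
      fix t
      have "(SUP n. indicator (I n) t * h t) = (SUP n. indicator (I n) t) * h t"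
        by (rule SUP_mult_right_ennreal[symmetric])
      also have "(SUP n. indicator (I n) t :: ennreal) = indicator (\<Union>n. I n) t"
      proof (cases "t \<in> (\<Union>n. I n)")
        case True
        then obtain k where "t \<in> I k" by auto
        then show ?thesis
          by (intro antisym SUP_least SUP_upper2[of k]) (auto simp: indicator_def)
      qed simp
      finally show "indicator (\<Union>n. I n) t * h t = (SUP n. indicator (I n) t * h t)" ..
    qed
    also have "\<dots> = (SUP n. \<integral>\<^sup>+t. indicator (I n) t * h t \<partial>lborel)"
      using \<open>incseq I\<close>
      by (intro nn_integral_monotone_convergence_SUP) (auto simp: incseq_def le_fun_def indicator_def split: split_indicator)
    finally show ?thesis .
  qed
  have step: "(\<integral>\<^sup>+s. indicator (K n) s * \<phi> s \<partial>lborel) =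
    (\<integral>\<^sup>+t. indicator (J n) t * (ennreal (d / t\<^sup>2) * \<phi> (d / t)) \<partial>lborel)" for n
  proof -
    let ?a = "1 / (real n + 2)" and ?b = "real n + 2"
    have ab: "0 < ?a" "?a < ?b"
      by (simp, rule less_trans[of _ 1]) auto
    have "(\<integral>\<^sup>+s. indicator (K n) s * \<phi> s \<partial>lborel) = (\<integral>\<^sup>+x. indicator (K n) (- x) * \<phi> (- x) \<partial>lborel)"
      \<comment> \<open>The map from t to d / t decreases, while
        \<open>nn_integral_substitution_aux\<close> expects a nonnegative derivative; after this
        reflection the map is - d / t.\<close>
      by (subst nn_integral_real_affine[where c="-1" and t=0]) auto
    also have "\<dots> = (\<integral>\<^sup>+x. \<phi> (- x) * indicator {- d / ?a .. - d / ?b} x \<partial>lborel)"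
      by (intro nn_integral_cong) (auto simp: K_def indicator_def)
    also have "\<dots> = (\<integral>\<^sup>+t. \<phi> (- (- d / t)) * ennreal (d / t\<^sup>2) * indicator {?a..?b} t \<partial>lborel)"
    proof (rule nn_integral_substitution_aux)
      show "continuous_on {?a..?b} (\<lambda>t. d / t\<^sup>2)"
        using ab by (intro continuous_intros) auto
      show "((\<lambda>t. - d / t) has_real_derivative d / t\<^sup>2) (at t)" if "t \<in> {?a..?b}" for t
      proof -
        have "t \<noteq> 0" using that ab by auto
        then show ?thesis by (auto intro!: derivative_eq_intros simp: power2_eq_square)
      qed
    qed (use ab d in auto)
    also have "\<dots> = (\<integral>\<^sup>+t. indicator (J n) t * (ennreal (d / t\<^sup>2) * \<phi> (d / t)) \<partial>lborel)"
      by (intro nn_integral_cong) (auto simp: J_def mult_ac)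
    finally show ?thesis .
  qed
  show ?thesis
    using lim[OF \<open>incseq J\<close>, of "\<lambda>t. ennreal (d / t\<^sup>2) * \<phi> (d / t)"] lim[OF \<open>incseq K\<close>, of \<phi>]
    by (simp add: UJ UK step)
qed

text \<open>With a = (x - \<mu>) / \<tau> and b = a + (x' - x) / \<tau>, the Jacobian splits: at
  fixed \<tau> the passage from \<mu> to a is affine with factor \<tau>, and at fixed a the
  difference b - a is reciprocal in \<tau>.\<close>

lemma nn_integral_interval_params:
  fixes G :: "real \<times> real \<Rightarrow> real"
  assumes G[measurable]: "G \<in> borel_measurable (borel \<Otimes>\<^sub>M borel)" and x: "x < x'"
  shows "(\<integral>\<^sup>+\<theta>. indicator param_space \<theta> * ennreal ((x' - x) / (snd \<theta>) ^ 3 *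
      G ((x - fst \<theta>) / snd \<theta>, (x' - fst \<theta>) / snd \<theta>)) \<partial>lborel) =
    (\<integral>\<^sup>+a. \<integral>\<^sup>+b. indicator {a<..} b * ennreal (G (a, b)) \<partial>lborel \<partial>lborel)"
proof -
  let ?d = "x' - x"
  let ?f = "\<lambda>\<theta>. indicator param_space \<theta> * ennreal (?d / (snd \<theta>) ^ 3 *
      G ((x - fst \<theta>) / snd \<theta>, (x' - fst \<theta>) / snd \<theta>)) :: ennreal"
  have [measurable]: "param_space \<in> sets (borel \<Otimes>\<^sub>M borel)" by (simp add: param_space_def)
  have f[measurable]: "?f \<in> borel_measurable (borel \<Otimes>\<^sub>M borel)" by measurable
  have d: "0 < ?d" using x by simp
  have "(\<integral>\<^sup>+\<theta>. ?f \<theta> \<partial>lborel) = (\<integral>\<^sup>+\<theta>. ?f \<theta> \<partial>(lborel \<Otimes>\<^sub>M lborel))" by (simp add: lborel_prod)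
  also have "\<dots> = (\<integral>\<^sup>+\<tau>. \<integral>\<^sup>+\<mu>. ?f (\<mu>, \<tau>) \<partial>lborel \<partial>lborel)"
    by (rule lborel_pair.nn_integral_snd[symmetric]) measurable
  also have "\<dots> = (\<integral>\<^sup>+\<tau>. \<integral>\<^sup>+a. indicator {0<..} \<tau> * ennreal (?d / \<tau>\<^sup>2 * G (a, a + ?d / \<tau>)) \<partial>lborel \<partial>lborel)"
  proof (rule nn_integral_cong)
    fix \<tau>
    show "(\<integral>\<^sup>+\<mu>. ?f (\<mu>, \<tau>) \<partial>lborel) = (\<integral>\<^sup>+a. indicator {0<..} \<tau> * ennreal (?d / \<tau>\<^sup>2 * G (a, a + ?d / \<tau>)) \<partial>lborel)"
    proof (cases "0 < \<tau>")
      case True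
      have "(\<integral>\<^sup>+\<mu>. ?f (\<mu>, \<tau>) \<partial>lborel) = (\<integral>\<^sup>+\<mu>. ennreal (?d / \<tau> ^ 3 * G ((x - \<mu>) / \<tau>, (x' - \<mu>) / \<tau>)) \<partial>lborel)"
        using True by (simp add: param_space_def)
      also have "\<dots> = ennreal \<tau> * (\<integral>\<^sup>+a. ennreal (?d / \<tau> ^ 3 * G ((x - (x + - \<tau> * a)) / \<tau>, (x' - (x + - \<tau> * a)) / \<tau>)) \<partial>lborel)"
        using True by (subst nn_integral_real_affine[where c="- \<tau>" and t=x]) auto
      also have "\<dots> = ennreal \<tau> * (\<integral>\<^sup>+a. ennreal (?d / \<tau> ^ 3 * G (a, a + ?d / \<tau>)) \<partial>lborel)"
        using True by (intro arg_cong2[where f="(*)"] nn_integral_cong refl arg_cong[where f=ennreal] arg_cong[where f=G])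
          (auto simp: field_simps)
      also have "\<dots> = (\<integral>\<^sup>+a. ennreal \<tau> * ennreal (?d / \<tau> ^ 3 * G (a, a + ?d / \<tau>)) \<partial>lborel)"
        by (subst nn_integral_cmult) auto
      also have "\<dots> = (\<integral>\<^sup>+a. ennreal (?d / \<tau>\<^sup>2 * G (a, a + ?d / \<tau>)) \<partial>lborel)"
        using True by (intro nn_integral_cong)
          (simp add: ennreal_mult'[symmetric] power2_eq_square power3_eq_cube mult.assoc)
      finally show ?thesis using True by simp
    qed (simp add: param_space_def)
  qed
  also have "\<dots> = (\<integral>\<^sup>+a. \<integral>\<^sup>+\<tau>. indicator {0<..} \<tau> * ennreal (?d / \<tau>\<^sup>2 * G (a, a + ?d / \<tau>)) \<partial>lborel \<partial>lborel)"
    by (rule lborel_pair.Fubini') measurable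
  also have "\<dots> = (\<integral>\<^sup>+a. \<integral>\<^sup>+b. indicator {a<..} b * ennreal (G (a, b)) \<partial>lborel \<partial>lborel)"
  proof (rule nn_integral_cong)
    fix a
    have "(\<integral>\<^sup>+\<tau>. indicator {0<..} \<tau> * ennreal (?d / \<tau>\<^sup>2 * G (a, a + ?d / \<tau>)) \<partial>lborel) =
      (\<integral>\<^sup>+\<tau>. indicator {0<..} \<tau> * (ennreal (?d / \<tau>\<^sup>2) * ennreal (G (a, a + ?d / \<tau>))) \<partial>lborel)"
      using d by (intro nn_integral_cong arg_cong2[where f="(*)"] refl ennreal_mult') auto
    also have "\<dots> = (\<integral>\<^sup>+s. indicator {0<..} s * ennreal (G (a, a + s)) \<partial>lborel)"
      using d by (intro nn_integral_inverse_substitution) measurable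
    also have "\<dots> = (\<integral>\<^sup>+b. indicator {a<..} b * ennreal (G (a, b)) \<partial>lborel)"
      by (subst nn_integral_real_affine[where c=1 and t="- a"]) 
        (auto simp: indicator_def intro!: nn_integral_cong)
    finally show "(\<integral>\<^sup>+\<tau>. indicator {0<..} \<tau> * ennreal (?d / \<tau>\<^sup>2 * G (a, a + ?d / \<tau>)) \<partial>lborel) =
      (\<integral>\<^sup>+b. indicator {a<..} b * ennreal (G (a, b)) \<partial>lborel)" .
  qed
  finally show ?thesis .
qed

text \<open>Each \<open>W m\<close> is eventually a probability density with respect to
  \<open>N\<close>. Off \<open>U\<close> the function \<open>h\<close> may be unbounded, but there
  \<open>W m\<close> is uniformly small and the distance of \<open>h\<close> from c is integrable.
  No topology enters: \<open>U\<close> is just a set, supplied for each \<epsilon>.\<close>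

lemma approximate_identity:
  fixes N :: "'b measure" and h :: "'b \<Rightarrow> real" and W :: "nat \<Rightarrow> 'b \<Rightarrow> real"
  assumes N: "finite_measure N" and h: "integrable N h"
    and W: "\<forall>\<^sub>F m in sequentially. W m \<in> borel_measurable N \<and> (\<forall>x\<in>space N. 0 \<le> W m x) \<and>
      (\<integral>\<^sup>+x. ennreal (W m x) \<partial>N) = 1"
    and conc: "\<And>\<epsilon>. 0 < \<epsilon> \<Longrightarrow> \<exists>U. (\<forall>x\<in>U \<inter> space N. \<bar>h x - c\<bar> \<le> \<epsilon>) \<and>
      (\<forall>\<eta>>0. \<forall>\<^sub>F m in sequentially. \<forall>x\<in>space N - U. W m x \<le> \<eta>)"
  shows "(\<lambda>m. \<integral>x. W m x * h x \<partial>N) \<longlonglongrightarrow> c"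
proof (rule tendstoI)
  fix e :: real assume e: "0 < e"
  interpret finite_measure N by fact
  define I where "I = (\<integral>x. \<bar>h x - c\<bar> \<partial>N)"
  have hc: "integrable N (\<lambda>x. h x - c)" using h by simp
  have I0: "0 \<le> I" by (simp add: I_def)
  obtain U where U: "\<And>x. x \<in> U \<Longrightarrow> x \<in> space N \<Longrightarrow> \<bar>h x - c\<bar> \<le> e / 4"
    "\<And>\<eta>. 0 < \<eta> \<Longrightarrow> \<forall>\<^sub>F m in sequentially. \<forall>x\<in>space N - U. W m x \<le> \<eta>"
    using conc[of "e / 4"] e by auto
  \<comment> \<open>The two contributions to the error will be e / 4 and
    \<open>\<eta> * I \<le> e / 4\<close>; the summand 1 allows for \<open>I = 0\<close>.\<close>
  define \<eta> where "\<eta> = e / (4 * (I + 1))"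
  have \<eta>: "0 < \<eta>" "\<eta> * I \<le> e / 4" using e I0 by (auto simp: \<eta>_def field_simps)
  show "\<forall>\<^sub>F m in sequentially. dist (\<integral>x. W m x * h x \<partial>N) c < e"
    using W U(2)[OF \<eta>(1)]
  proof eventually_elim
    case (elim m)
    then have [measurable]: "W m \<in> borel_measurable N" and W0: "\<And>x. x \<in> space N \<Longrightarrow> 0 \<le> W m x" by auto
    have intW: "integrable N (W m)"
      using elim W0 by (intro integrableI_nonneg) (auto intro: AE_I2)
    have W1: "(\<integral>x. W m x \<partial>N) = 1"
      using elim W0 by (subst integral_eq_nn_integral) (auto intro: AE_I2)
    \<comment> \<open>Adding the bounds on and off \<open>U\<close>, instead of splitting the
      integral, avoids any measurability of \<open>U\<close>.\<close>
    have bd: "\<bar>W m x * (h x - c)\<bar> \<le> e / 4 * W m x + \<eta> * \<bar>h x - c\<bar>" if x: "x \<in> space N" for x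
    proof (cases "x \<in> U")
      case True
      then have "W m x * \<bar>h x - c\<bar> \<le> W m x * (e / 4)" using U(1) x W0 by (intro mult_left_mono) auto
      moreover have "0 \<le> \<eta> * \<bar>h x - c\<bar>" using \<eta> by simp
      ultimately show ?thesis using W0[OF x] by (simp add: abs_mult mult.commute)
    next
      case False
      then have "W m x * \<bar>h x - c\<bar> \<le> \<eta> * \<bar>h x - c\<bar>" using elim x by (intro mult_right_mono) auto
      moreover have "0 \<le> e / 4 * W m x" using W0[OF x] e by simp
      ultimately show ?thesis using W0[OF x] by (simp add: abs_mult)
    qed
    have bint: "integrable N (\<lambda>x. e / 4 * W m x + \<eta> * \<bar>h x - c\<bar>)" using intW hc by auto
    have Whc: "integrable N (\<lambda>x. W m x * (h x - c))"
      using bd hc by (intro Bochner_Integration.integrable_bound[OF bint]) (auto intro!: AE_I2 order_trans[OF bd[unfolded abs_mult] abs_ge_self] simp: abs_mult simp del: times_divide_eq_left)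
    have "(\<integral>x. W m x * h x \<partial>N) = (\<integral>x. W m x * (h x - c) + c * W m x \<partial>N)"
      by (intro Bochner_Integration.integral_cong) (auto simp: algebra_simps)
    also have "\<dots> = (\<integral>x. W m x * (h x - c) \<partial>N) + c"
      using Whc intW W1 by simp
    finally have "dist (\<integral>x. W m x * h x \<partial>N) c = \<bar>\<integral>x. W m x * (h x - c) \<partial>N\<bar>" by (simp add: dist_real_def)
    also have "\<dots> \<le> (\<integral>x. \<bar>W m x * (h x - c)\<bar> \<partial>N)" by (rule integral_abs_bound)
    also have "\<dots> \<le> (\<integral>x. e / 4 * W m x + \<eta> * \<bar>h x - c\<bar> \<partial>N)"
      using Whc bint bd by (intro integral_mono) auto
    also have "\<dots> = e / 4 + \<eta> * I" using intW hc W1 by (simp add: I_def)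
    also have "\<dots> < e" using \<eta> e by linarith
    finally show ?case .
  qed
qed

section \<open>Quantiles\<close>

text \<open>The set in the infimum is closed because the cdf is continuous, so it contains its
  infimum, and there the cdf is at most p as a limit from the left. The second claim makes the
  quantile the leftmost point at level p, even if the cdf is flat afterwards.\<close>

lemma density_cdf_quantile:
  assumes g: "prob_density g" and p: "0 < p" "p < 1"
  shows "density_cdf g (quantile g p) = p" and "x < quantile g p \<Longrightarrow> density_cdf g x < p"
proof -
  interpret real_distribution "density lborel (\<lambda>x. ennreal (g x))"
    by (rule real_distribution_density) fact
  let ?F = "density_cdf g" and ?S = "{x. p \<le> density_cdf g x}"
  have "\<forall>\<^sub>F x in at_top. p < ?F x"
    using cdf_lim_at_top_prob p by (auto simp: density_cdf_def dest: order_tendstoD(1))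
  then obtain x1 where x1: "p < ?F x1" by (auto simp: eventually_at_top_linorder)
  have "\<forall>\<^sub>F x in at_bot. ?F x < p"
    using cdf_lim_at_bot p by (auto simp: density_cdf_def dest: order_tendstoD(2))
  then obtain x0 where x0: "?F x0 < p" by (auto simp: eventually_at_bot_linorder)
  have ne: "?S \<noteq> {}" using x1 by (auto intro: less_imp_le)
  have "x0 \<le> x" if "x \<in> ?S" for x
    using that x0 density_cdf_mono[OF g, of x x0] by (cases "x \<le> x0") auto
  then have bdd: "bdd_below ?S" by (auto intro!: bdd_belowI)
  have "closed ?S"
    using isCont_density_cdf[OF g] by (intro closed_Collect_le continuous_intros continuous_at_imp_continuous_on) auto
  then have "quantile g p \<in> ?S"
    unfolding quantile_def using ne bdd by (intro closed_contains_Inf) auto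
  then have ge: "p \<le> ?F (quantile g p)" by simp
  show lt: "?F x < p" if "x < quantile g p" for x
    using that cInf_lower[OF _ bdd, of x] by (force simp: quantile_def not_le[symmetric])
  have "(?F \<longlongrightarrow> ?F (quantile g p)) (at_left (quantile g p))"
    using isCont_density_cdf[OF g] by (simp add: isCont_def filterlim_at_split)
  moreover have "\<forall>\<^sub>F x in at_left (quantile g p). ?F x \<le> p"
    unfolding eventually_at_filter using lt by (auto intro!: always_eventually less_imp_le)
  ultimately have "?F (quantile g p) \<le> p"
    by (intro tendsto_upperbound) auto
  with ge show "?F (quantile g p) = p" by simp
qed

lemma quantile_eqI:
  assumes "density_cdf g q = p" "\<And>x. x < q \<Longrightarrow> density_cdf g x < p"
  shows "quantile g p = q"
  unfolding quantile_def using assms by (intro cInf_eq_minimum) (auto simp: not_less[symmetric])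

text \<open>Were the cdf flat to the right of \<open>q\<close>, the density would vanish almost
  everywhere on an interval where it is positive.\<close>

lemma density_cdf_less_right:
  assumes g: "prob_density g" and pos: "positive_continuous_near g q" and e: "0 < e"
  shows "density_cdf g q < density_cdf g (q + e)"
proof (rule ccontr)
  assume "\<not> density_cdf g q < density_cdf g (q + e)"
  then have eq: "density_cdf g (q + e) - density_cdf g q = 0"
    using density_cdf_mono[OF g, of q "q + e"] e by auto
  note [measurable] = prob_densityD(1)[OF g]
  obtain U where U: "open U" "q \<in> U" "\<And>x. x \<in> U \<Longrightarrow> 0 < g x"
    using pos by (auto simp: positive_continuous_near_def)
  then obtain r where r: "0 < r" "\<And>x. dist x q < r \<Longrightarrow> x \<in> U"
    unfolding open_dist by blast
  define s where "s = min r e"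
  have s: "0 < s" "s \<le> r" "s \<le> e" using r e by (auto simp: s_def)
  have "(\<integral>\<^sup>+x. ennreal (g x) * indicator {q<..<q + e} x \<partial>lborel) = 0"
    using nn_integral_density_between[OF g, of q "q + e"] e eq by simp
  then have "AE x in lborel. ennreal (g x) * indicator {q<..<q + e} x = 0"
    by (subst (asm) nn_integral_0_iff_AE) auto
  then have "AE x in lborel. x \<notin> {q<..<q + s}"
  proof eventually_elim
    fix x assume x: "ennreal (g x) * indicator {q<..<q + e} x = 0"
    show "x \<notin> {q<..<q + s}"
    proof
      assume "x \<in> {q<..<q + s}"
      then have "0 < g x" "x \<in> {q<..<q + e}"
        using s by (auto intro!: U(3) r(2) simp: dist_real_def)
      then show False using x by simp
    qed
  qed
  then have "emeasure lborel {q<..<q + s} = 0"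
    by (subst (asm) AE_iff_measurable[of "{q<..<q + s}"]) auto
  then show False using s by simp
qed

text \<open>The cdf must pass strictly through level p on both sides of the quantile: on the left
  this comes from the infimum, on the right from the positive density.\<close>

lemma density_cdf_inverse_continuous:
  assumes g: "prob_density g" and p: "0 < p" "p < 1"
    and pos: "positive_continuous_near g (quantile g p)" and e: "0 < e"
  obtains d where "0 < d" "\<And>x. \<bar>density_cdf g x - p\<bar> < d \<Longrightarrow> \<bar>x - quantile g p\<bar> < e"
proof
  let ?q = "quantile g p" and ?F = "density_cdf g"
  let ?d = "min (p - ?F (?q - e)) (?F (?q + e) - p)"
  note Fq = density_cdf_quantile[OF g p]
  show "0 < ?d" using Fq(2)[of "?q - e"] density_cdf_less_right[OF g pos e] e by (simp add: Fq(1))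
  show "\<bar>x - ?q\<bar> < e" if x: "\<bar>?F x - p\<bar> < ?d" for x
  proof (rule ccontr)
    assume "\<not> \<bar>x - ?q\<bar> < e"
    then consider "x \<le> ?q - e" | "?q + e \<le> x" by linarith
    then show False
    proof cases
      case 1
      then have "?F x \<le> ?F (?q - e)" by (rule density_cdf_mono[OF g])
      then show False using x by (auto simp: min_def split: if_splits)
    next
      case 2
      then have "?F (?q + e) \<le> ?F x" by (rule density_cdf_mono[OF g])
      then show False using x by (auto simp: min_def split: if_splits)
    qed
  qed
qed

section \<open>Limit of the interval density\<close>

context location_scale_family
begin

section \<open>Quantiles of the family, the Jacobian and the limiting parameter\<close>

lemma quantile_f:
  assumes \<theta>: "\<theta> \<in> param_space" and p: "0 < p" "p < 1"
  shows "quantile (f \<theta>) p = fst \<theta> + snd \<theta> * quantile f0 p"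
proof (rule quantile_eqI)
  have \<tau>: "0 < snd \<theta>" using \<theta> by (auto simp: param_space_def)
  show "density_cdf (f \<theta>) (fst \<theta> + snd \<theta> * quantile f0 p) = p"
    using \<tau> by (simp add: density_cdf_f[OF \<theta>] density_cdf_quantile[OF f0 p])
  show "density_cdf (f \<theta>) x < p" if "x < fst \<theta> + snd \<theta> * quantile f0 p" for x
    unfolding density_cdf_f[OF \<theta>] using that \<tau>
    by (intro density_cdf_quantile(2)[OF f0 p]) (simp add: field_simps)
qed

text \<open>By \<open>quantile_f\<close>, the p-quantile is \<mu> + \<tau> q, so the rows of the
  matrix are (1, q) and (1, q').\<close>

lemma det_quantile_jacobian:
  assumes \<theta>: "\<theta> \<in> param_space" and p: "0 < p" "p < 1" and p': "0 < p'" "p' < 1"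
  shows "det (quantile_jacobian f p p' \<theta>) = quantile f0 p' - quantile f0 p"
proof -
  obtain \<mu> \<tau> where \<theta>': "\<theta> = (\<mu>, \<tau>)" by (cases \<theta>)
  then have \<tau>: "0 < \<tau>" using \<theta> by (auto simp: param_space_def)
  have 1: "deriv (\<lambda>a. quantile (f (a, \<tau>)) r) \<mu> = 1" if r: "0 < r" "r < 1" for r
  proof -
    have "(\<lambda>a. quantile (f (a, \<tau>)) r) = (\<lambda>a. a + \<tau> * quantile f0 r)"
      using \<tau> by (auto simp: fun_eq_iff quantile_f[OF _ r] param_space_def)
    then show ?thesis by (auto intro!: DERIV_imp_deriv derivative_eq_intros)
  qed
  have 2: "deriv (\<lambda>b. quantile (f (\<mu>, b)) r) \<tau> = quantile f0 r" if r: "0 < r" "r < 1" for r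
  proof -
    \<comment> \<open>The formula for the quantile is available for b > 0 only, so the two functions
      agree near \<tau>, which is enough for the derivative.\<close>
    have "\<forall>\<^sub>F b in nhds \<tau>. b \<in> {0<..}" using \<tau> by (intro eventually_nhds_in_open) auto
    then have "\<forall>\<^sub>F b in nhds \<tau>. quantile (f (\<mu>, b)) r = \<mu> + b * quantile f0 r"
      by eventually_elim (simp add: quantile_f[OF _ r] param_space_def)
    then have "deriv (\<lambda>b. quantile (f (\<mu>, b)) r) \<tau> = deriv (\<lambda>b. \<mu> + b * quantile f0 r) \<tau>"
      by (rule deriv_cong_ev) simp
    also have "\<dots> = quantile f0 r" by (auto intro!: DERIV_imp_deriv derivative_eq_intros)
    finally show ?thesis .
  qed
  show ?thesis
    using p p' by (simp add: \<theta>' quantile_jacobian_def det_2 vector_2 1 2)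
qed

lemma quantile_less:
  assumes p: "0 < p" "p < p'" "p' < 1"
  shows "quantile f0 p < quantile f0 p'"
proof (rule ccontr)
  assume "\<not> ?thesis"
  then have "density_cdf f0 (quantile f0 p') \<le> density_cdf f0 (quantile f0 p)"
    by (intro density_cdf_mono[OF f0]) simp
  then show False using p by (simp add: density_cdf_quantile[OF f0])
qed

text \<open>The two quantile equations are linear in (\<mu>, \<tau>) and solved explicitly;
  identifiability turns this solution into the value of \<open>THE\<close>.\<close>

lemma limit_density_eq:
  assumes p: "0 < p" "p < p'" "p' < 1" and x: "x < x'" and ident: "identifiable_at f p p'"
  defines "\<tau> \<equiv> (x' - x) / (quantile f0 p' - quantile f0 p)"
  shows "(x - \<tau> * quantile f0 p, \<tau>) \<in> param_space"
    and "limit_density f \<pi> p p' x x' =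
      \<pi> (x - \<tau> * quantile f0 p, \<tau>) / (quantile f0 p' - quantile f0 p)"
proof -
  let ?q = "quantile f0 p" and ?q' = "quantile f0 p'"
  let ?\<theta> = "(x - \<tau> * ?q, \<tau>)"
  have q: "?q < ?q'" by (rule quantile_less[OF p])
  then have \<tau>: "0 < \<tau>" "\<tau> * (?q' - ?q) = x' - x" using x by (auto simp: \<tau>_def)
  show \<theta>: "?\<theta> \<in> param_space" using \<tau> by (simp add: param_space_def)
  have "solves_quantiles f p p' x x' ?\<theta>"
    using \<theta> p \<tau>(2) by (simp add: solves_quantiles_def quantile_f algebra_simps)
  then have "quantile_params f p p' x x' = ?\<theta>"
    unfolding quantile_params_def using ident x
    by (intro the1_equality) (auto simp: identifiable_at_def)
  then show "limit_density f \<pi> p p' x x' = \<pi> ?\<theta> / (?q' - ?q)"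
    using q p \<theta> by (simp add: limit_density_def det_quantile_jacobian divide_inverse)
qed

text \<open>As a function of \<theta> at fixed endpoints, the integrand is the order statistic
  density of \<open>f0\<close> in other coordinates, so its total mass is 1.\<close>

lemma nn_integral_iid_interval_density_f:
  assumes l: "0 < l" "l < u" "u \<le> m" and x: "x < x'"
  shows "(\<integral>\<^sup>+\<theta>. indicator param_space \<theta> *
    ennreal (iid_interval_density (f \<theta>) m l u x x' * ((x' - x) / snd \<theta>)) \<partial>lborel) = 1"
proof -
  note [measurable] = borel_measurable_iid_interval_density[OF f0] prob_densityD(1)[OF f0]
  let ?G = "\<lambda>(a, b). iid_interval_density f0 m l u a b"
  have "(\<integral>\<^sup>+\<theta>. indicator param_space \<theta> *
      ennreal (iid_interval_density (f \<theta>) m l u x x' * ((x' - x) / snd \<theta>)) \<partial>lborel) =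
    (\<integral>\<^sup>+\<theta>. indicator param_space \<theta> * ennreal ((x' - x) / (snd \<theta>) ^ 3 *
      ?G ((x - fst \<theta>) / snd \<theta>, (x' - fst \<theta>) / snd \<theta>)) \<partial>lborel)"
    by (intro nn_integral_cong)
      (auto simp: indicator_def iid_interval_density_f power2_eq_square power3_eq_cube mult_ac)
  also have "\<dots> = (\<integral>\<^sup>+a. \<integral>\<^sup>+b. indicator {a<..} b * ennreal (?G (a, b)) \<partial>lborel \<partial>lborel)"
    using x by (intro nn_integral_interval_params) measurable
  also have "\<dots> = (\<integral>\<^sup>+a. \<integral>\<^sup>+b. ennreal (iid_interval_density f0 m l u a b) * indicator UNIV (a, b) \<partial>lborel \<partial>lborel)"
  proof (rule nn_integral_cong, rule nn_integral_cong_AE)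
    fix a :: real
    show "AE b in lborel. indicator {a<..} b * ennreal (?G (a, b)) =
        ennreal (iid_interval_density f0 m l u a b) * indicator UNIV (a, b)"
      using AE_lborel_singleton[of a] 
      by eventually_elim (auto simp: indicator_def iid_interval_density_def)
  qed
  also have "\<dots> = (\<integral>\<^sup>+x. (\<Prod>k\<in>{1..m}. ennreal (f0 (x k))) * indicator UNIV (order_interval m l u x)
      \<partial>PiM {1..m} (\<lambda>_. lborel :: real measure))"
    \<comment> \<open>The mass of the order statistic density is read off from the sample itself,
      with the whole plane as the event.\<close>
    by (rule nn_integral_order_interval[OF f0 l, symmetric]) simp
  also have "\<dots> = (\<Prod>k\<in>{1..m}. \<integral>\<^sup>+x. ennreal (f0 x) \<partial>lborel)"
    by (subst lborel_family.product_nn_integral_prod[symmetric]) auto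
  also have "\<dots> = 1" by (simp add: prob_densityD(3)[OF f0])
  finally show ?thesis .
qed

text \<open>\<open>D\<close> is the parameter density of mass 1 for (3, 1, 2),
  \<open>W m * D\<close> the one for (m, l m, u m), and \<open>h\<close> is \<open>\<pi>\<close>
  divided by the factor (x' - x) / \<tau> that they contain. Hence the integral of
  \<open>W m * h\<close> against \<open>N\<close> is the interval density, and integrability of
  \<open>h\<close> is exactly condition iii for (3, 1, 2).\<close>

lemma interval_density_tendsto:
  fixes l u :: "nat \<Rightarrow> nat"
  assumes lp: "(\<lambda>m. real (l m) / (real m + 1)) \<longlonglongrightarrow> p"
    and up: "(\<lambda>m. real (u m) / (real m + 1)) \<longlonglongrightarrow> p'"
    and p: "0 < p" "p < p'" "p' < 1" and x: "x < x'"
    and pos: "positive_continuous_near f0 (quantile f0 p)" "positive_continuous_near f0 (quantile f0 p')"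
    and \<pi>_meas: "(\<lambda>\<theta>. indicator param_space \<theta> * \<pi> \<theta>) \<in> borel_measurable borel"
    and \<pi>0: "\<And>\<theta>. \<theta> \<in> param_space \<Longrightarrow> 0 \<le> \<pi> \<theta>"
    and fin: "(\<integral>\<^sup>+\<theta>\<in>param_space. ennreal (\<bar>iid_interval_density (f \<theta>) 3 1 2 x x'\<bar> * \<pi> \<theta>) \<partial>lborel) < \<infinity>"
  defines "\<tau> \<equiv> (x' - x) / (quantile f0 p' - quantile f0 p)"
  assumes cont: "isCont \<pi> (x - \<tau> * quantile f0 p, \<tau>)"
  shows "(\<lambda>m. interval_density f \<pi> m (l m) (u m) x x') \<longlonglongrightarrow>
    \<pi> (x - \<tau> * quantile f0 p, \<tau>) / (quantile f0 p' - quantile f0 p)"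
proof -
  let ?q = "quantile f0 p" and ?q' = "quantile f0 p'" and ?F = "density_cdf f0"
  define A where "A \<theta> = (x - fst \<theta>) / snd \<theta>" for \<theta> :: "real \<times> real"
  define B where "B \<theta> = (x' - fst \<theta>) / snd \<theta>" for \<theta> :: "real \<times> real"
  define D where "D \<theta> = indicator param_space \<theta> * iid_interval_density (f \<theta>) 3 1 2 x x' * ((x' - x) / snd \<theta>)" for \<theta>
  define h where "h \<theta> = indicator param_space \<theta> * \<pi> \<theta> * (snd \<theta> / (x' - x))" for \<theta>
  define W where "W m \<theta> = (if \<theta> \<in> param_space then order_weight m (l m) (u m) (?F (A \<theta>)) (?F (B \<theta>)) else 0)" for m \<theta>
  define N where "N = density lborel (\<lambda>\<theta>. ennreal (D \<theta>))"
  have [measurable]: "param_space \<in> sets (borel :: (real \<times> real) measure)"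
    by (simp add: param_space_def borel_prod[symmetric])
  note [measurable] = \<pi>_meas borel_measurable_density_cdf[OF f0]
  have [measurable]: "fst \<in> borel_measurable (borel :: (real \<times> real) measure)"
      "snd \<in> borel_measurable (borel :: (real \<times> real) measure)"
    by (simp_all add: borel_prod[symmetric])
  have D_meas[measurable]: "D \<in> borel_measurable borel"
  proof -
    have "(\<lambda>\<theta>. indicator param_space \<theta> * iid_interval_density (f \<theta>) 3 1 2 x x') \<in> borel_measurable borel"
      using measurable_compose[OF measurable_Pair2' borel_measurable_iid_interval_density_f[of 3 1 2], of "(x, x')"]
      by (simp add: space_pair_measure)
    then show ?thesis unfolding D_def by measurable
  qed
  have h_meas[measurable]: "h \<in> borel_measurable borel" unfolding h_def by measurable
  have W_meas[measurable]: "W m \<in> borel_measurable borel" for m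
    unfolding W_def order_weight_def A_def B_def by measurable
  have param_pos: "0 < snd \<theta>" if "\<theta> \<in> param_space" for \<theta> using that by (auto simp: param_space_def)
  have D0: "0 \<le> D \<theta>" for \<theta>
  proof (cases "\<theta> \<in> param_space")
    case True
    show ?thesis
      unfolding D_def using x param_pos[OF True] iid_interval_density_nonneg[OF prob_density_f[OF True]]
      by (intro mult_nonneg_nonneg) auto
  qed (simp add: D_def)
  have AB: "A \<theta> \<le> B \<theta>" if "\<theta> \<in> param_space" for \<theta>
    using x param_pos[OF that] by (simp add: A_def B_def divide_right_mono)
  have F: "0 \<le> ?F (A \<theta>)" "?F (A \<theta>) \<le> ?F (B \<theta>)" "?F (B \<theta>) \<le> 1" if "\<theta> \<in> param_space" for \<theta>
    using density_cdf_mono[OF f0 AB[OF that]] density_cdf_nonneg density_cdf_le_1[OF f0] by auto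
  have W0: "0 \<le> W m \<theta>" for m \<theta>
    using F[of \<theta>] by (auto simp: W_def intro!: order_weight_nonneg)
  have WD: "W m \<theta> * D \<theta> = indicator param_space \<theta> * iid_interval_density (f \<theta>) m (l m) (u m) x x' * ((x' - x) / snd \<theta>)"
    if "0 < l m" "l m < u m" "u m < m" for m \<theta>
    using iid_interval_density_eq_order_weight[OF that, of "f \<theta>" x x']
    by (auto simp: W_def D_def A_def B_def density_cdf_f indicator_def)
  have N_mass: "emeasure N (space N) = 1"
  proof -
    have "emeasure N (space N) = (\<integral>\<^sup>+\<theta>. ennreal (D \<theta>) \<partial>lborel)"
      by (simp add: N_def emeasure_density)
    also have "\<dots> = (\<integral>\<^sup>+\<theta>. indicator param_space \<theta> *
        ennreal (iid_interval_density (f \<theta>) 3 1 2 x x' * ((x' - x) / snd \<theta>)) \<partial>lborel)"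
      by (intro nn_integral_cong) (auto simp: D_def indicator_def)
    also have "\<dots> = 1" using x by (intro nn_integral_iid_interval_density_f) auto
    finally show ?thesis .
  qed
  have fin_N: "finite_measure N" by (rule finite_measureI) (simp add: N_mass)
  have "integrable N h"
  proof (rule integrableI_bounded)
    show "h \<in> borel_measurable N" by (simp add: N_def)
    have "(\<integral>\<^sup>+\<theta>. ennreal (norm (h \<theta>)) \<partial>N) = (\<integral>\<^sup>+\<theta>. ennreal (D \<theta>) * ennreal (norm (h \<theta>)) \<partial>lborel)"
      unfolding N_def by (subst nn_integral_density) auto
    also have "\<dots> = (\<integral>\<^sup>+\<theta>\<in>param_space. ennreal (\<bar>iid_interval_density (f \<theta>) 3 1 2 x x'\<bar> * \<pi> \<theta>) \<partial>lborel)"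
    proof (rule nn_integral_cong)
      fix \<theta>
      show "ennreal (D \<theta>) * ennreal (norm (h \<theta>)) =
        ennreal (\<bar>iid_interval_density (f \<theta>) 3 1 2 x x'\<bar> * \<pi> \<theta>) * indicator param_space \<theta>"
      proof (cases "\<theta> \<in> param_space")
        case True
        have "D \<theta> * norm (h \<theta>) = \<bar>iid_interval_density (f \<theta>) 3 1 2 x x'\<bar> * \<pi> \<theta>"
          using True x param_pos[OF True] \<pi>0[OF True] iid_interval_density_nonneg[OF prob_density_f[OF True], of 3 1 2 x x']
          by (simp add: D_def h_def abs_mult)
        then show ?thesis using True D0[of \<theta>] by (simp add: ennreal_mult[symmetric] del: real_norm_def)
      qed (simp add: D_def)
    qed
    also have "\<dots> < \<infinity>" by (rule fin)
    finally show "(\<integral>\<^sup>+\<theta>. ennreal (norm (h \<theta>)) \<partial>N) < \<infinity>" .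
  qed
  moreover have W_ev: "\<forall>\<^sub>F m in sequentially. 0 < l m \<and> l m < u m \<and> u m < m"
    \<comment> \<open>Only the inequalities between the ranks are wanted here; both values 1 are
      arbitrary positive numbers.\<close>
    using order_weight_uniform[OF lp up p, of 1 1] by (auto elim: eventually_mono)
  moreover have "\<forall>\<^sub>F m in sequentially. W m \<in> borel_measurable N \<and> (\<forall>\<theta>\<in>space N. 0 \<le> W m \<theta>) \<and>
      (\<integral>\<^sup>+\<theta>. ennreal (W m \<theta>) \<partial>N) = 1"
    using W_ev
  proof eventually_elim
    case (elim m)
    have "(\<integral>\<^sup>+\<theta>. ennreal (W m \<theta>) \<partial>N) = (\<integral>\<^sup>+\<theta>. ennreal (W m \<theta> * D \<theta>) \<partial>lborel)"
      unfolding N_def using W0 D0 by (subst nn_integral_density) (auto simp: ennreal_mult mult.commute)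
    also have "\<dots> = (\<integral>\<^sup>+\<theta>. indicator param_space \<theta> *
        ennreal (iid_interval_density (f \<theta>) m (l m) (u m) x x' * ((x' - x) / snd \<theta>)) \<partial>lborel)"
      using elim by (intro nn_integral_cong) (auto simp: WD indicator_def)
    also have "\<dots> = 1" using elim x by (intro nn_integral_iid_interval_density_f) auto
    finally show ?case using W0 by (simp add: N_def)
  qed
  moreover have "\<exists>U. (\<forall>\<theta>\<in>U \<inter> space N. \<bar>h \<theta> - \<pi> (x - \<tau> * ?q, \<tau>) / (?q' - ?q)\<bar> \<le> \<epsilon>) \<and>
      (\<forall>\<eta>>0. \<forall>\<^sub>F m in sequentially. \<forall>\<theta>\<in>space N - U. W m \<theta> \<le> \<eta>)" if \<epsilon>: "0 < \<epsilon>" for \<epsilon>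
  proof -
    have q: "?q < ?q'" by (rule quantile_less[OF p])
    have \<tau>: "0 < \<tau>" using q x by (simp add: \<tau>_def)
    \<comment> \<open>\<open>T\<close> inverts the standardisation: the difference of the endpoints
      \<open>A \<theta>\<close> and \<open>B \<theta>\<close> yields \<tau>, and the lower one then
      yields \<mu>.\<close>
    define T where "T ab = (x - (x' - x) / (snd ab - fst ab) * fst ab, (x' - x) / (snd ab - fst ab))" for ab :: "real \<times> real"
    have T0: "T (?q, ?q') = (x - \<tau> * ?q, \<tau>)" by (simp add: T_def \<tau>_def)
    have T_cont: "isCont T (?q, ?q')"
      unfolding T_def using q by (intro continuous_intros) auto
    have "isCont (\<lambda>ab. \<pi> (T ab) * (snd (T ab) / (x' - x))) (?q, ?q')"
      using x by (intro continuous_intros isCont_o2[OF T_cont] cont[folded T0] T_cont) auto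
    moreover have "\<pi> (T (?q, ?q')) * (snd (T (?q, ?q')) / (x' - x)) = \<pi> (x - \<tau> * ?q, \<tau>) / (?q' - ?q)"
      unfolding T0 using x by (simp add: \<tau>_def)
    ultimately obtain r where r: "0 < r" and
      rD: "\<And>ab. dist ab (?q, ?q') < r \<Longrightarrow>
        \<bar>\<pi> (T ab) * (snd (T ab) / (x' - x)) - \<pi> (x - \<tau> * ?q, \<tau>) / (?q' - ?q)\<bar> < \<epsilon>"
      using \<epsilon> unfolding continuous_at_eps_delta dist_real_def by metis
    have r2: "0 < r / 2" using r by simp
    obtain d1 where d1: "0 < d1" "\<And>a. \<bar>?F a - p\<bar> < d1 \<Longrightarrow> \<bar>a - ?q\<bar> < r / 2"
      using density_cdf_inverse_continuous[OF f0 _ _ pos(1) r2] p by auto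
    obtain d2 where d2: "0 < d2" "\<And>b. \<bar>?F b - p'\<bar> < d2 \<Longrightarrow> \<bar>b - ?q'\<bar> < r / 2"
      using density_cdf_inverse_continuous[OF f0 _ _ pos(2) r2] p by auto
    define \<delta> where "\<delta> = min d1 d2"
    \<comment> \<open>The neighbourhood is described by cdf values, since these are what
      \<open>W m\<close> depends on; by the choice of \<open>d1\<close> and \<open>d2\<close> it is
      small in (a, b) as well.\<close>
    define U where "U = {\<theta> \<in> param_space. \<bar>?F (A \<theta>) - p\<bar> < \<delta> \<and> \<bar>?F (B \<theta>) - p'\<bar> < \<delta>}"
    have \<delta>: "0 < \<delta>" using d1 d2 by (simp add: \<delta>_def)
    have "\<bar>h \<theta> - \<pi> (x - \<tau> * ?q, \<tau>) / (?q' - ?q)\<bar> \<le> \<epsilon>" if "\<theta> \<in> U" for \<theta>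
    proof -
      have \<theta>: "\<theta> \<in> param_space" using that by (simp add: U_def)
      have s: "0 < snd \<theta>" by (rule param_pos[OF \<theta>])
      have "\<bar>A \<theta> - ?q\<bar> < r / 2" "\<bar>B \<theta> - ?q'\<bar> < r / 2"
        using that d1 d2 by (auto simp: U_def \<delta>_def)
      then have "dist (A \<theta>, B \<theta>) (?q, ?q') < r"
        using sqrt_sum_squares_le_sum_abs[of "A \<theta> - ?q" "B \<theta> - ?q'"]
        by (simp add: dist_Pair_Pair dist_real_def)
      moreover have "B \<theta> - A \<theta> = (x' - x) / snd \<theta>"
        by (simp add: A_def B_def diff_divide_distrib)
      then have "T (A \<theta>, B \<theta>) = \<theta>"
        using s x by (simp add: T_def A_def prod_eq_iff)
      ultimately show ?thesis using rD[of "(A \<theta>, B \<theta>)"] \<theta> by (simp add: h_def)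
    qed
    moreover have "\<forall>\<^sub>F m in sequentially. \<forall>\<theta>\<in>space N - U. W m \<theta> \<le> \<eta>" if \<eta>: "0 < \<eta>" for \<eta>
      using order_weight_uniform[OF lp up p \<delta> \<eta>]
    proof eventually_elim
      case (elim m)
      show ?case
      proof
        fix \<theta> assume "\<theta> \<in> space N - U"
        then show "W m \<theta> \<le> \<eta>"
          \<comment> \<open>Off \<open>param_space\<close> the weight is 0 by definition, hence
            below \<eta>.\<close>
          using elim F[of \<theta>] \<eta> by (cases "\<theta> \<in> param_space") (auto simp: W_def U_def not_less)
      qed
    qed
    ultimately show ?thesis by (intro exI[of _ U]) auto
  qed
  ultimately have lim: "(\<lambda>m. \<integral>\<theta>. W m \<theta> * h \<theta> \<partial>N) \<longlonglongrightarrow> \<pi> (x - \<tau> * ?q, \<tau>) / (?q' - ?q)"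
    by (intro approximate_identity[OF fin_N])
  have "\<forall>\<^sub>F m in sequentially. (\<integral>\<theta>. W m \<theta> * h \<theta> \<partial>N) = interval_density f \<pi> m (l m) (u m) x x'"
    using W_ev
  proof eventually_elim
    case (elim m)
    have "(\<integral>\<theta>. W m \<theta> * h \<theta> \<partial>N) = (\<integral>\<theta>. D \<theta> *\<^sub>R (W m \<theta> * h \<theta>) \<partial>lborel)"
      unfolding N_def using D0 by (intro integral_density) auto
    also have "\<dots> = interval_density f \<pi> m (l m) (u m) x x'"
      unfolding interval_density_def set_lebesgue_integral_def
    proof (intro Bochner_Integration.integral_cong refl)
      fix \<theta>
      have "D \<theta> *\<^sub>R (W m \<theta> * h \<theta>) = (W m \<theta> * D \<theta>) * h \<theta>" by simp
      also have "\<dots> = indicator param_space \<theta> *\<^sub>R (iid_interval_density (f \<theta>) m (l m) (u m) x x' * \<pi> \<theta>)"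
        \<comment> \<open>The factor (x' - x) / \<tau> of \<open>D\<close> cancels against \<tau> /
          (x' - x) in \<open>h\<close>.\<close>
        using elim x param_pos[of \<theta>] by (auto simp: WD h_def indicator_def)
      finally show "D \<theta> *\<^sub>R (W m \<theta> * h \<theta>) =
        indicator param_space \<theta> *\<^sub>R (iid_interval_density (f \<theta>) m (l m) (u m) x x' * \<pi> \<theta>)" .
    qed
    finally show ?case .
  qed
  from Lim_transform_eventually[OF lim this] show ?thesis .
qed

end

theorem theorem5:
  fixes M :: "'a measure"
    and \<Theta> :: "'a \<Rightarrow> real \<times> real"
    and X :: "nat \<Rightarrow> 'a \<Rightarrow> real"
    and f :: "real \<times> real \<Rightarrow> real \<Rightarrow> real"
    and \<pi> :: "real \<times> real \<Rightarrow> real"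
    and l u :: "nat \<Rightarrow> nat"
    and p p' :: real
  assumes "prob_space M"
    and "\<forall>\<theta>\<in>param_space. 0 \<le> \<pi> \<theta>"
    and "distributed M lborel \<Theta> (\<lambda>\<theta>. ennreal (\<pi> \<theta>) * indicator param_space \<theta>)"
    and "cond_iid M \<Theta> f X"
    and "location_scale_density f"
    and "interval_identifiable f l u p p'"
    and "(\<lambda>m. real (l m) / (real m + 1)) \<longlonglongrightarrow> p"
    and "(\<lambda>m. real (u m) / (real m + 1)) \<longlonglongrightarrow> p'"
    and "0 < p" and "p < p'" and "p' < 1"
    and "twice_differentiable_on \<pi> param_space"
    and "\<forall>\<theta>\<in>param_space. positive_continuous_near (f \<theta>) (quantile (f \<theta>) p) \<and>
           positive_continuous_near (f \<theta>) (quantile (f \<theta>) p')"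
    and "\<forall>m i j x x'. 0 < i \<and> i < j \<and> j < m \<and> x < x' \<longrightarrow>
           (\<integral>\<^sup>+\<theta>\<in>param_space. ennreal (\<bar>iid_interval_density (f \<theta>) m i j x x'\<bar> * \<pi> \<theta>) \<partial>lborel) < \<infinity>"
  shows "(\<forall>m. 0 < l m \<and> l m < u m \<and> u m < m \<longrightarrow>
            distributed M lborel (\<lambda>\<omega>. order_interval m (l m) (u m) (\<lambda>i. X i \<omega>))
              (\<lambda>(x, x'). ennreal (interval_density f \<pi> m (l m) (u m) x x'))) \<and>
         (\<forall>x x'. x < x' \<longrightarrow>
            (\<lambda>m. interval_density f \<pi> m (l m) (u m) x x') \<longlonglongrightarrow> limit_density f \<pi> p p' x x')"
proof (intro conjI allI impI)
  obtain f0 where f0: "prob_density f0"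
    and f_eq: "\<And>\<mu> \<tau> x. 0 < \<tau> \<Longrightarrow> f (\<mu>, \<tau>) x = f0 ((x - \<mu>) / \<tau>) / \<tau>"
    using assms(5) by (auto simp: location_scale_density_def)
  interpret location_scale_family f f0
    by unfold_locales (fact f0, fact f_eq)
  have \<pi>0: "0 \<le> \<pi> \<theta>" if "\<theta> \<in> param_space" for \<theta>
    using assms(2) that by blast
  have fin: "(\<integral>\<^sup>+\<theta>\<in>param_space. ennreal (\<bar>iid_interval_density (f \<theta>) m i j x x'\<bar> * \<pi> \<theta>) \<partial>lborel) < \<infinity>"
    if "0 < i" "i < j" "j < m" "x < x'" for m i j x x'
    using assms(14) that by blast
  {
    fix m assume m: "0 < l m \<and> l m < u m \<and> u m < m"
    show "distributed M lborel (\<lambda>\<omega>. order_interval m (l m) (u m) (\<lambda>i. X i \<omega>))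
        (\<lambda>(x, x'). ennreal (interval_density f \<pi> m (l m) (u m) x x'))"
      using m by (intro distributed_order_interval[OF assms(1,3,4)] \<pi>0 fin) auto
  next
    fix x x' :: real assume x: "x < x'"
    have ident: "identifiable_at f p p'"
      using assms(6) by (simp add: interval_identifiable_def)
    note limit = limit_density_eq[OF assms(9,10,11) x ident]
    \<comment> \<open>At (0, 1) the member of the family is \<open>f0\<close> itself, which turns
      condition ii into a statement about the quantiles of \<open>f0\<close>.\<close>
    have "(0, 1) \<in> param_space" by (simp add: param_space_def)
    moreover have "f (0, 1) = f0" by (simp add: fun_eq_iff f_eq)
    ultimately have pos: "positive_continuous_near f0 (quantile f0 p)"
        "positive_continuous_near f0 (quantile f0 p')"
      using assms(13) by fastforce+
    have "(\<lambda>\<theta>. ennreal (\<pi> \<theta>) * indicator param_space \<theta>) \<in> borel_measurable borel"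
      using distributed_borel_measurable[OF assms(3)] by simp
    note \<pi>_meas = borel_measurable_indicator_mult[OF this \<pi>0]
    have "isCont \<pi> \<theta>" if "\<theta> \<in> param_space" for \<theta>
      using assms(12) that unfolding twice_differentiable_on_def by (meson has_derivative_continuous)
    from this[OF limit(1)] show "(\<lambda>m. interval_density f \<pi> m (l m) (u m) x x') \<longlonglongrightarrow> limit_density f \<pi> p p' x x'"
      unfolding limit(2)
      by (intro interval_density_tendsto assms(7-11) x pos \<pi>_meas \<pi>0 fin) auto
  }
qed

end
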